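(* Let $X$ be a Polish $G$-space. Suppose that for every $\alpha<\omega_1$ and every $G$-invariant comeager subset $C\subseteq X$ there exist $x,y\in C$ with $x\sim_\alpha y$ but $[x]\ne[y]$. Then for no comeager $X_0\subseteq X$ is the restriction of $E_X$ to $X_0$ classifiable by countable structures (i.e., Borel reducible to the isomorphism relation on $\mathrm{Mod}(L)$, the Polish space of structures with universe $\mathbb N$, for some countable classical signature $L$).
   Context: A Polish $G$-space is a continuous action of a Polish group $G$ on a Polish space $X$; $E_X$ is the orbit equivalence relation and $[x]$ the orbit of $x$. Game $\mathrm{Appr}_\alpha(x,y)$ for $x,y\in X$, $\alpha<\omega_1$: put $x_0=x$, $y_0=y$, $V^y_0=G$, $U^y_0=X$, $\alpha_0=\alpha$. For $n\ge0$, in turn $2n+1$ Odd either sets $V^x_n=V^y_n$ and $\alpha_{2n+1}=\alpha_{2n}$, or chooses a new open neighborhood $V^x_n$ of $1$ in $G$ together with an ordinal $\alpha_{2n+1}<\alpha_{2n}$; he then plays an open neighborhood $U^x_n$ of $x_n$, and Eve answers with $g^y_n\in G$, setting $y_{n+1}=g^y_n.y_n$. In turn $2n+2$ Odd either sets $V^y_{n+1}=V^x_n$ and $\alpha_{2n+2}=\alpha_{2n+1}$, or chooses a new open neighborhood $V^y_{n+1}$ of $1$ with $\alpha_{2n+2}<\alpha_{2n+1}$; he then plays an open neighborhood $U^y_{n+1}$ of $y_{n+1}$, and Eve answers with $g^x_n\in G$, setting $x_{n+1}=g^x_n.x_n$. Eve wins if for every $n\ge0$: $y_{n+1}\in\overline{U^x_n}$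 and $x_n\in\overline{U^y_n}$; $g^y_n=h_k\cdots h_0$ for some $k\ge0$ and $h_0,\dots,h_k\in V^y_n$ with $h_i\cdots h_0.y_n\in U^y_n$ for all $i\le k$; and $g^x_n=h_k\cdots h_0$ for some $k\ge0$ and $h_0,\dots,h_k\in V^x_n$ with $h_i\cdots h_0.x_n\in U^x_n$ for all $i\le k$. Write $x\sim_\alpha y$ if Eve has a winning strategy in $\mathrm{Appr}_\alpha(x,y)$. *)

theory Defs
  imports "HOL-Analysis.Analysis"
begin

section \<open>Polish G-spaces\<close>

text \<open>
  The Polish group is written additively: \<^class>\<open>topological_group_add\<close> is the library's class
  of (not necessarily commutative) topological groups. The complete metric that comes with
  \<^class>\<open>polish_space\<close> is used only through its topology and need not be related to the group
  operation.
\<close>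

locale polish_G_space =
  fixes act :: "'g :: {polish_space, topological_group_add} \<Rightarrow> 'x :: polish_space \<Rightarrow> 'x"
  assumes act_zero: "act 0 x = x"
    and act_add: "act (g + h) x = act g (act h x)"
    and act_continuous: "continuous_on UNIV (\<lambda>(g, x). act g x)"

definition orb :: "('g \<Rightarrow> 'x \<Rightarrow> 'x) \<Rightarrow> 'x \<Rightarrow> 'x set" where
  "orb act x = {act g x | g. True}"

definition orbit_eq :: "('g \<Rightarrow> 'x \<Rightarrow> 'x) \<Rightarrow> 'x \<Rightarrow> 'x \<Rightarrow> bool" where
  "orbit_eq act x y \<longleftrightarrow> orb act x = orb act y"

definition G_invariant :: "('g \<Rightarrow> 'x \<Rightarrow> 'x) \<Rightarrow> 'x set \<Rightarrow> bool" where
  "G_invariant act C \<longleftrightarrow> (\<forall>g. \<forall>x\<in>C. act g x \<in> C)"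

definition nowhere_dense :: "'x :: topological_space set \<Rightarrow> bool" where
  "nowhere_dense N \<longleftrightarrow> interior (closure N) = {}"

definition meager :: "'x :: topological_space set \<Rightarrow> bool" where
  "meager A \<longleftrightarrow> (\<exists>N :: nat \<Rightarrow> 'x set. (\<forall>n. nowhere_dense (N n)) \<and> A = (\<Union>n. N n))"

definition comeager :: "'x :: topological_space set \<Rightarrow> bool" where
  "comeager C \<longleftrightarrow> meager (- C)"


section \<open>The game Appr\<close>

text \<open>
  Countable ordinals are the elements of the field of the cardinal successor of \<open>\<aleph>\<^sub>0\<close>, which is a
  well-order of type \<open>\<omega>\<^sub>1\<close>; thus \<open>\<beta> < \<alpha>\<close> reads \<open>\<beta> \<in> underS omega1 \<alpha>\<close>. The carrier type
  \<^typ>\<open>nat set\<close> is merely the one on which the library places this successor.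
\<close>

abbreviation omega1 :: "nat set rel" where
  "omega1 \<equiv> cardSuc natLeq"

datatype ('g, 'x) odd_move =
  Odd_Move (nbhd1: "'g set") (ordnl: "nat set") (nbhd: "'x set")

text \<open>
  A play is recorded by a sequence \<open>m\<close> of moves of Odd indexed by turns together with Eve's
  answers. \<open>m 0\<close> holds the initial data \<open>V\<^sup>y\<^sub>0 = G\<close>, \<open>\<alpha>\<^sub>0 = \<alpha>\<close>, \<open>U\<^sup>y\<^sub>0 = X\<close>, and the move made by
  Odd in turn \<open>t > 0\<close> is \<open>m t\<close>; so \<open>m (2n+1) = (V\<^sup>x\<^sub>n, \<alpha>\<^bsub>2n+1\<^esub>, U\<^sup>x\<^sub>n)\<close> and
  \<open>m (2n) = (V\<^sup>y\<^sub>n, \<alpha>\<^bsub>2n\<^esub>, U\<^sup>y\<^sub>n)\<close>. Eve's answers are \<open>gy n\<close> in turn \<open>2n+1\<close> and \<open>gx n\<close> in turn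
  \<open>2n+2\<close>.
\<close>

primrec track :: "('g \<Rightarrow> 'x \<Rightarrow> 'x) \<Rightarrow> (nat \<Rightarrow> 'g) \<Rightarrow> 'x \<Rightarrow> nat \<Rightarrow> 'x" where
  "track act g x 0 = x"
| "track act g x (Suc n) = act (g n) (track act g x n)"

definition odd_legal ::
  "('g :: {topological_space, zero} \<Rightarrow> 'x :: topological_space \<Rightarrow> 'x) \<Rightarrow> nat set \<Rightarrow> 'x \<Rightarrow> 'x \<Rightarrow>
    (nat \<Rightarrow> ('g, 'x) odd_move) \<Rightarrow> (nat \<Rightarrow> 'g) \<Rightarrow> (nat \<Rightarrow> 'g) \<Rightarrow> bool" where
  "odd_legal act \<alpha> x y m gx gy \<longleftrightarrow>
    m 0 = Odd_Move UNIV \<alpha> UNIV \<and>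
    (\<forall>t. nbhd1 (m (Suc t)) = nbhd1 (m t) \<and> ordnl (m (Suc t)) = ordnl (m t) \<or>
         open (nbhd1 (m (Suc t))) \<and> 0 \<in> nbhd1 (m (Suc t)) \<and>
           ordnl (m (Suc t)) \<in> underS omega1 (ordnl (m t))) \<and>
    (\<forall>n. open (nbhd (m (2*n+1))) \<and> track act gx x n \<in> nbhd (m (2*n+1))) \<and>
    (\<forall>n. open (nbhd (m (2*n+2))) \<and> track act gy y (n+1) \<in> nbhd (m (2*n+2)))"

text \<open>The product \<open>h\<^sub>i \<cdots> h\<^sub>0\<close>, in additive notation.\<close>

definition rprod :: "(nat \<Rightarrow> 'g :: monoid_add) \<Rightarrow> nat \<Rightarrow> 'g" where
  "rprod h i = sum_list (map h (rev [0..<Suc i]))"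

definition local_move ::
  "('g :: monoid_add \<Rightarrow> 'x \<Rightarrow> 'x) \<Rightarrow> 'g set \<Rightarrow> 'x set \<Rightarrow> 'x \<Rightarrow> 'g \<Rightarrow> bool" where
  "local_move act V U z g \<longleftrightarrow>
    (\<exists>k h. (\<forall>i\<le>k. h i \<in> V) \<and> g = rprod h k \<and> (\<forall>i\<le>k. act (rprod h i) z \<in> U))"

definition eve_wins ::
  "('g :: monoid_add \<Rightarrow> 'x :: topological_space \<Rightarrow> 'x) \<Rightarrow> 'x \<Rightarrow> 'x \<Rightarrow>
    (nat \<Rightarrow> ('g, 'x) odd_move) \<Rightarrow> (nat \<Rightarrow> 'g) \<Rightarrow> (nat \<Rightarrow> 'g) \<Rightarrow> bool" where
  "eve_wins act x y m gx gy \<longleftrightarrow>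
    (\<forall>n. track act gy y (n+1) \<in> closure (nbhd (m (2*n+1))) \<and>
         track act gx x n \<in> closure (nbhd (m (2*n))) \<and>
         local_move act (nbhd1 (m (2*n))) (nbhd (m (2*n))) (track act gy y n) (gy n) \<and>
         local_move act (nbhd1 (m (2*n+1))) (nbhd (m (2*n+1))) (track act gx x n) (gx n))"

text \<open>
  A strategy \<open>\<sigma>\<close> of Eve gives her answer in turn \<open>t\<close> as a function of the list of the moves of Odd
  in turns \<open>1, \<dots>, t\<close> (her own earlier answers being determined by \<open>\<sigma>\<close>).
\<close>

definition appr_sim ::
  "('g :: {topological_space, monoid_add} \<Rightarrow> 'x :: topological_space \<Rightarrow> 'x) \<Rightarrow> nat set \<Rightarrow>
    'x \<Rightarrow> 'x \<Rightarrow> bool" where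
  "appr_sim act \<alpha> x y \<longleftrightarrow>
    (\<exists>\<sigma> :: ('g, 'x) odd_move list \<Rightarrow> 'g. \<forall>m.
      let gy = (\<lambda>n. \<sigma> (map m [1..<2*n+2]));
          gx = (\<lambda>n. \<sigma> (map m [1..<2*n+3]))
      in odd_legal act \<alpha> x y m gx gy \<longrightarrow> eve_wins act x y m gx gy)"


section \<open>Classification by countable structures\<close>

text \<open>
  A countable signature, with symbols coded by natural numbers. Relation and function symbols
  live in separate name spaces; constants are function symbols of arity 0.
\<close>

record signature =
  rel_syms :: "nat set"
  rel_arity :: "nat \<Rightarrow> nat"
  fun_syms :: "nat set"
  fun_arity :: "nat \<Rightarrow> nat"

definition rel_args :: "signature \<Rightarrow> (nat \<times> nat list) set" where
  "rel_args L = (SIGMA r:rel_syms L. {v. length v = rel_arity L r})"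

definition fun_args :: "signature \<Rightarrow> (nat \<times> nat list) set" where
  "fun_args L = (SIGMA f:fun_syms L. {v. length v = fun_arity L f})"

type_synonym nat_structure = "(nat \<times> nat list \<Rightarrow> bool) \<times> (nat \<times> nat list \<Rightarrow> nat)"

text \<open>
  The space \<open>Mod L = (\<Prod>\<^sub>R 2^(\<nat>^ar R)) \<times> (\<Prod>\<^sub>f \<nat>^(\<nat>^ar f))\<close>, with its product topology.
\<close>

definition Mod :: "signature \<Rightarrow> nat_structure topology" where
  "Mod L = prod_topology
     (product_topology (\<lambda>_. discrete_topology UNIV) (rel_args L))
     (product_topology (\<lambda>_. discrete_topology UNIV) (fun_args L))"

definition Mod_iso :: "signature \<Rightarrow> nat_structure \<Rightarrow> nat_structure \<Rightarrow> bool" where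
  "Mod_iso L M N \<longleftrightarrow>
    (\<exists>p :: nat \<Rightarrow> nat. bij p \<and>
      (\<forall>(r, v) \<in> rel_args L. fst M (r, v) \<longleftrightarrow> fst N (r, map p v)) \<and>
      (\<forall>(f, v) \<in> fun_args L. p (snd M (f, v)) = snd N (f, map p v)))"

definition borel_of_topology :: "'a topology \<Rightarrow> 'a measure" where
  "borel_of_topology T = sigma (topspace T) {U. openin T U}"

definition borel_reducible ::
  "'a measure \<Rightarrow> ('a \<Rightarrow> 'a \<Rightarrow> bool) \<Rightarrow> 'b measure \<Rightarrow> ('b \<Rightarrow> 'b \<Rightarrow> bool) \<Rightarrow> bool" where
  "borel_reducible A E B F \<longleftrightarrow>
    (\<exists>f \<in> A \<rightarrow>\<^sub>M B. \<forall>x\<in>space A. \<forall>y\<in>space A. E x y \<longleftrightarrow> F (f x) (f y))"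

definition classifiable_by_countable_structures ::
  "'a measure \<Rightarrow> ('a \<Rightarrow> 'a \<Rightarrow> bool) \<Rightarrow> bool" where
  "classifiable_by_countable_structures A E \<longleftrightarrow>
    (\<exists>L. borel_reducible A E (borel_of_topology (Mod L)) (Mod_iso L))"

end

theory Submission
  imports Defs
begin

text \<open>
  Suppose \<open>f\<close> reduces \<open>E\<^sub>X\<close> on a comeager set to isomorphism of countable structures, and compare
  tuples in the structures \<open>f x\<close> by the back-and-forth relations of countable rank. These relations
  are Borel in \<open>x\<close>, so the countable chain condition for category provides one countable rank at
  which, for generic \<open>x\<close>, the back-and-forth relation on the tuples of \<open>f x\<close> is stable; from then on
  it is the orbit relation of the automorphism group.

  Isomorphisms from \<open>f x\<close> to \<open>f (g x)\<close> cannot be chosen canonically. A tuple is therefore named by a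
  pair of an open set \<open>O \<subseteq> G\<close> and a tuple \<open>a\<close> such that the type of \<open>a\<close> in \<open>f (g x)\<close> is the same
  for generic \<open>g \<in> O\<close>. Near every point of an invariant comeager set \<open>C\<close> there are plenty of names
  that are valid on a neighbourhood, and such a name keeps its meaning under local moves by
  elements \<open>h\<close> with \<open>O \<inter> O h \<noteq> \<emptyset>\<close>. Odd can thus play the back-and-forth game inside \<open>Appr\<close>, spending
  one ordinal per extension of the tuple, and \<open>x \<sim>\<^sub>\<alpha> y\<close> with \<open>x, y \<in> C\<close> makes \<open>f (g x)\<close> and
  \<open>f (h y)\<close> equivalent of rank \<open>\<alpha>\<close> for generic \<open>g\<close> and \<open>h\<close>. When \<open>\<alpha>\<close> lies beyond the stable rank,
  the two structures are isomorphic and the orbits agree.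
\<close>

section \<open>Baire category\<close>

lemma meager_subset:
  assumes "meager A" "B \<subseteq> A"
  shows "meager B"
proof -
  obtain N where N: "\<And>n::nat. nowhere_dense (N n)" "A = (\<Union>n. N n)"
    using assms(1) by (auto simp: meager_def)
  have "nowhere_dense (N n \<inter> B)" for n
    using N(1)[of n] unfolding nowhere_dense_def
    by (metis closure_mono inf_le1 interior_mono subset_empty)
  moreover have "B = (\<Union>n. N n \<inter> B)"
    using N(2) assms(2) by auto
  ultimately show ?thesis
    unfolding meager_def by (intro exI[of _ "\<lambda>n. N n \<inter> B"]) auto
qed

lemma nowhere_dense_imp_meager: "nowhere_dense A \<Longrightarrow> meager A"
  unfolding meager_def by (intro exI[of _ "\<lambda>_. A"]) auto

lemma meager_empty [simp]: "meager {}"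
  by (rule nowhere_dense_imp_meager) (simp add: nowhere_dense_def)

lemma meager_UN_nat:
  fixes A :: "nat \<Rightarrow> 'a :: topological_space set"
  assumes "\<And>n. meager (A n)"
  shows "meager (\<Union>n. A n)"
proof -
  obtain N where N: "\<And>n k::nat. nowhere_dense (N n k)" "\<And>n. A n = (\<Union>k. N n k)"
    using assms unfolding meager_def by metis
  have "(\<Union>n. A n) = (\<Union>j. case_prod N (prod_decode j))" (is "?L = ?R")
  proof
    show "?L \<subseteq> ?R"
    proof
      fix x assume "x \<in> ?L"
      then obtain n k where "x \<in> N n k"
        using N(2) by auto
      then have "x \<in> case_prod N (prod_decode (prod_encode (n, k)))"
        by simp
      then show "x \<in> ?R" by (rule UN_I[OF UNIV_I])
    qed
    show "?R \<subseteq> ?L"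
      using N(2) by (auto split: prod.splits)
  qed
  then show ?thesis
    unfolding meager_def using N(1)
    by (intro exI[of _ "\<lambda>j. case_prod N (prod_decode j)"]) (auto split: prod.splits)
qed

lemma meager_UN:
  assumes "countable I" "\<And>i. i \<in> I \<Longrightarrow> meager (A i)"
  shows "meager (\<Union>i\<in>I. A i)"
proof (cases "I = {}")
  case False
  have "(\<Union>i\<in>I. A i) = (\<Union>n. A (from_nat_into I n))"
    using range_from_nat_into[OF False assms(1)] by (metis image_image)
  then show ?thesis
    using assms(2) False from_nat_into by (metis meager_UN_nat)
qed simp

lemma meager_Un: "meager A \<Longrightarrow> meager B \<Longrightarrow> meager (A \<union> B)"
  using meager_UN[of "{True, False}" "\<lambda>b. if b then A else B"] by (simp add: Un_commute)

text \<open>The category quantifier as a filter: nested uses are iterated quantifiers "for all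
  points outside a meager set", and generic facts combine by \<open>eventually_elim\<close>.\<close>

definition generic :: "'a :: topological_space set \<Rightarrow> 'a filter" where
  "generic U = Abs_filter (\<lambda>P. meager {x \<in> U. \<not> P x})"

lemma eventually_generic: "eventually P (generic U) \<longleftrightarrow> meager {x \<in> U. \<not> P x}"
  unfolding generic_def
proof (rule eventually_Abs_filter, rule is_filter.intro)
  show "meager {x \<in> U. \<not> True}" by simp
next
  fix P Q :: "'a \<Rightarrow> bool"
  assume "meager {x \<in> U. \<not> P x}" "meager {x \<in> U. \<not> Q x}"
  from meager_Un[OF this] show "meager {x \<in> U. \<not> (P x \<and> Q x)}"
    by (rule meager_subset) auto
next
  fix P Q :: "'a \<Rightarrow> bool"
  assume "\<forall>x. P x \<longrightarrow> Q x" "meager {x \<in> U. \<not> P x}"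
  then show "meager {x \<in> U. \<not> Q x}"
    by (elim meager_subset) auto
qed

lemma comeager_iff_generic: "comeager C \<longleftrightarrow> (\<forall>\<^sub>F x in generic UNIV. x \<in> C)"
  by (simp add: comeager_def eventually_generic Compl_eq)

lemma generic_ball_countable:
  assumes "countable I" "\<And>i. i \<in> I \<Longrightarrow> \<forall>\<^sub>F x in generic U. P i x"
  shows "\<forall>\<^sub>F x in generic U. \<forall>i\<in>I. P i x"
proof -
  have "meager (\<Union>i\<in>I. {x \<in> U. \<not> P i x})"
    using assms by (intro meager_UN) (auto simp: eventually_generic)
  then show ?thesis
    unfolding eventually_generic by (rule meager_subset) auto
qed

lemma generic_all_countable:
  fixes P :: "'i :: countable \<Rightarrow> _"
  assumes "\<And>i. \<forall>\<^sub>F x in generic U. P i x"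
  shows "\<forall>\<^sub>F x in generic U. \<forall>i. P i x"
  using generic_ball_countable[where I=UNIV and U=U and P=P] assms by auto

lemma generic_subset: "\<forall>\<^sub>F x in generic U. P x \<Longrightarrow> V \<subseteq> U \<Longrightarrow> \<forall>\<^sub>F x in generic V. P x"
  unfolding eventually_generic by (erule meager_subset) auto

lemma generic_mem: "\<forall>\<^sub>F x in generic U. x \<in> U"
  by (simp add: eventually_generic)

lemma not_meager_open:
  fixes U :: "'a :: complete_space set"
  assumes "open U" "U \<noteq> {}"
  shows "\<not> meager U"
proof
  assume "meager U"
  then obtain N where N: "\<And>n::nat. nowhere_dense (N n)" "U = (\<Union>n. N n)"
    by (auto simp: meager_def)
  have cm: "completely_metrizable_space (euclidean :: 'a topology)"
  proof -
    have "Met_TC.mcomplete TYPE('a)"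
      using complete_UNIV by simp
    then show ?thesis
      by (metis Met_TC.completely_metrizable_space_mtopology mtopology_is_euclidean)
  qed
  have "euclidean interior_of \<Union> (range (\<lambda>n. closure (N n))) = {}"
    by (rule Baire_category_alt) (use cm N(1) in \<open>auto simp: nowhere_dense_def\<close>)
  then have "interior (\<Union>n. closure (N n)) = {}"
    by simp
  moreover have "U \<subseteq> (\<Union>n. closure (N n))"
    using N(2) closure_subset by blast
  ultimately show False
    using assms interior_maximal by blast
qed

lemma generic_ex:
  fixes U :: "'a :: complete_space set"
  assumes "\<forall>\<^sub>F x in generic U. P x" "open U" "U \<noteq> {}"
  obtains x where "x \<in> U" "P x"
proof -
  have "{x \<in> U. \<not> P x} \<noteq> U"
    using assms not_meager_open by (metis eventually_generic)
  then show ?thesis using that by blast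
qed

lemma generic_open_dense:
  assumes "open U" "open D" "\<And>B. open B \<Longrightarrow> B \<noteq> {} \<Longrightarrow> B \<subseteq> U \<Longrightarrow> B \<inter> D \<noteq> {}"
  shows "\<forall>\<^sub>F x in generic U. x \<in> D"
proof -
  let ?B = "interior (closure (U - D))"
  have "?B = {}"
  proof (rule ccontr)
    assume "?B \<noteq> {}"
    then have "?B \<inter> U \<noteq> {}"
      using interior_subset[of "closure (U - D)"] open_Int_closure_eq_empty[of ?B "U - D"] by blast
    then have "(?B \<inter> U) \<inter> D \<noteq> {}"
      using assms(1) assms(3)[of "?B \<inter> U"] by blast
    moreover have "open ((?B \<inter> U) \<inter> D)"
      using assms by blast
    moreover have "(?B \<inter> U) \<inter> D \<subseteq> closure (U - D)"
      using interior_subset by blast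
    ultimately show False
      using open_Int_closure_eq_empty[of "(?B \<inter> U) \<inter> D" "U - D"] by blast
  qed
  then have "meager (U - D)"
    by (intro nowhere_dense_imp_meager) (simp add: nowhere_dense_def)
  then show ?thesis
    by (simp add: eventually_generic set_diff_eq)
qed

section \<open>Borel sets up to meager sets\<close>

lemma borel_imp_eventually_open:
  fixes A :: "'a :: topological_space set"
  assumes "A \<in> sets borel"
  shows "\<exists>W. open W \<and> (\<forall>\<^sub>F x in generic UNIV. x \<in> A \<longleftrightarrow> x \<in> W)"
proof -
  have "A \<in> sigma_sets UNIV {S. open S}"
    using assms by (simp add: borel_def)
  then show ?thesis
  proof induction
    case (Basic A)
    then show ?case by auto
  next
    case Empty
    then show ?case by (intro exI[of _ "{}"]) auto
  next
    case (Compl A)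
    then obtain W where W: "open W" "\<forall>\<^sub>F x in generic UNIV. x \<in> A \<longleftrightarrow> x \<in> W"
      by auto
    \<comment> \<open>The Baire property passes to complements because the boundary of
      \<open>W\<close> is nowhere dense: \<open>interior (- W)\<close> is almost equal to
      \<open>- W\<close>.\<close>
    have "\<forall>\<^sub>F x in generic UNIV. x \<in> W \<union> interior (- W)"
    proof (rule generic_open_dense)
      fix B :: "'a set"
      assume B: "open B" "B \<noteq> {}"
      show "B \<inter> (W \<union> interior (- W)) \<noteq> {}"
      proof (cases "B \<subseteq> - W")
        case True
        then show ?thesis
          using B interior_maximal by blast
      qed auto
    qed (use W in auto)
    then have "\<forall>\<^sub>F x in generic UNIV. x \<in> UNIV - A \<longleftrightarrow> x \<in> interior (- W)"
      using W(2) by eventually_elim (use interior_subset in auto)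
    then show ?case by blast
  next
    case (Union A)
    then obtain W where W: "\<And>i. open (W i)"
      "\<And>i. \<forall>\<^sub>F x in generic UNIV. x \<in> A i \<longleftrightarrow> x \<in> W i"
      by metis
    have "\<forall>\<^sub>F x in generic UNIV. \<forall>i. x \<in> A i \<longleftrightarrow> x \<in> W i"
      using W(2) by (rule generic_all_countable)
    then have "\<forall>\<^sub>F x in generic UNIV. x \<in> (\<Union>i. A i) \<longleftrightarrow> x \<in> (\<Union>i. W i)"
      by eventually_elim auto
    then show ?case
      using W(1) by blast
  qed
qed

text \<open>The Baire property gives an open \<open>W\<close> almost equal to \<open>A\<close>; it
  meets \<open>U\<close>, since otherwise \<open>A\<close> would be meager in \<open>U\<close>. This
  is how a nonmeager case becomes an open set below.\<close>

lemma borel_generic_localize: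
  fixes A :: "'a :: topological_space set"
  assumes "A \<in> sets borel" "open U" "\<not> (\<forall>\<^sub>F x in generic U. x \<notin> A)"
  obtains V where "open V" "V \<noteq> {}" "V \<subseteq> U" "\<forall>\<^sub>F x in generic V. x \<in> A"
proof -
  obtain W where W: "open W" "\<forall>\<^sub>F x in generic UNIV. x \<in> A \<longleftrightarrow> x \<in> W"
    using borel_imp_eventually_open assms(1) by blast
  show thesis
  proof (rule that[of "U \<inter> W"])
    show "open (U \<inter> W)" using assms W by blast
    show "U \<inter> W \<noteq> {}"
    proof
      assume *: "U \<inter> W = {}"
      have "\<forall>\<^sub>F x in generic U. x \<notin> A"
        using generic_mem[of U] generic_subset[OF W(2), of U, simplified]
        by eventually_elim (use * in blast)
      with assms show False by blast
    qed
    show "\<forall>\<^sub>F x in generic (U \<inter> W). x \<in> A"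
      using generic_mem[of "U \<inter> W"] generic_subset[OF W(2), of "U \<inter> W", simplified]
      by eventually_elim blast
  qed simp
qed

definition cbase :: "'a :: second_countable_topology set set" where
  "cbase = (SOME \<B>. countable \<B> \<and> topological_basis \<B>)"

lemma cbase: "countable cbase" "topological_basis cbase"
  using someI_ex[OF ex_countable_basis] unfolding cbase_def by auto

lemma cbase_open: "B \<in> cbase \<Longrightarrow> open B"
  using cbase(2) topological_basis_open by blast

lemma cbase_within:
  assumes "open U" "x \<in> U"
  obtains B where "B \<in> cbase" "x \<in> B" "B \<subseteq> U"
  using topological_basisE[OF cbase(2) assms] by blast

section \<open>Borel sets under the category quantifier\<close>

lemma borel_section:
  fixes B :: "('z :: topological_space \<times> 'g :: topological_space) set"
  assumes "B \<in> sets borel"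
  shows "{g. (z, g) \<in> B} \<in> sets borel"
proof -
  have "(\<lambda>g. (z, g)) \<in> borel_measurable borel"
    by (intro borel_measurable_continuous_onI continuous_intros)
  from measurable_sets[OF this assms] show ?thesis
    by (simp add: vimage_def)
qed

text \<open>By localization, \<open>B\<close> is generically avoided on \<open>U\<close> iff it is
  generic on no nonempty basic open subset of \<open>U\<close>. These are countably many Borel
  conditions.\<close>

lemma borel_generic_compl:
  fixes B :: "('z :: topological_space \<times> 'g :: polish_space) set"
  assumes B: "B \<in> sets borel"
    and "\<And>V. open V \<Longrightarrow> {z. \<forall>\<^sub>F g in generic V. (z, g) \<in> B} \<in> sets borel"
    and U: "open U"
  shows "{z. \<forall>\<^sub>F g in generic U. (z, g) \<notin> B} \<in> sets borel"
proof -
  define I where "I = {V \<in> cbase. V \<noteq> {} \<and> V \<subseteq> U}"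
  have "countable I"
    unfolding I_def using cbase(1) by (rule countable_subset[rotated]) auto
  have "(\<forall>\<^sub>F g in generic U. (z, g) \<notin> B) \<longleftrightarrow> (\<forall>V\<in>I. \<not> (\<forall>\<^sub>F g in generic V. (z, g) \<in> B))" for z
  proof (intro iffI ballI notI)
    fix V assume V: "V \<in> I" "\<forall>\<^sub>F g in generic V. (z, g) \<in> B"
      and *: "\<forall>\<^sub>F g in generic U. (z, g) \<notin> B"
    have "V \<subseteq> U" using V(1) by (simp add: I_def)
    from generic_subset[OF * this] V(2) have "\<forall>\<^sub>F g in generic V. False"
      by eventually_elim simp
    then show False
      using V(1) generic_ex cbase_open unfolding I_def by blast
  next
    assume *: "\<forall>V\<in>I. \<not> (\<forall>\<^sub>F g in generic V. (z, g) \<in> B)"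
    show "\<forall>\<^sub>F g in generic U. (z, g) \<notin> B"
    proof (rule ccontr)
      assume "\<not> ?thesis"
      then obtain V where V: "open V" "V \<noteq> {}" "V \<subseteq> U" "\<forall>\<^sub>F g in generic V. g \<in> {g. (z, g) \<in> B}"
        using borel_generic_localize[OF borel_section[OF B] U, of z] by auto
      then obtain V' where "V' \<in> cbase" "V' \<noteq> {}" "V' \<subseteq> V"
        using cbase_within by (metis all_not_in_conv)
      then show False
        using * V generic_subset[OF V(4), of V'] unfolding I_def by auto
    qed
  qed
  then have "{z. \<forall>\<^sub>F g in generic U. (z, g) \<notin> B}
      = - (\<Union>V\<in>I. {z. \<forall>\<^sub>F g in generic V. (z, g) \<in> B})"
    by auto
  also have "\<dots> \<in> sets borel"
    by (intro borel_comp sets.countable_UN'' \<open>countable I\<close> assms(2))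
       (auto simp: I_def cbase_open)
  finally show ?thesis .
qed

lemma borel_generic:
  fixes B :: "('z :: topological_space \<times> 'g :: polish_space) set"
  assumes "B \<in> sets borel" "open U"
  shows "{z. \<forall>\<^sub>F g in generic U. (z, g) \<in> B} \<in> sets borel"
proof -
  have "B \<in> sigma_sets UNIV {S. open S}"
    using assms(1) by (simp add: borel_def)
  then show ?thesis
    using assms(2)
  proof (induction arbitrary: U)
    case (Basic B)
    then have B: "open B" by simp
    have op: "open {z. \<exists>g\<in>V. (z, g) \<in> B}" for V
    proof -
      have "{z. \<exists>g\<in>V. (z, g) \<in> B} = (\<Union>g\<in>V. (\<lambda>z. (z, g)) -` B)"
        by auto
      also have "open \<dots>"
        by (intro open_UN ballI open_vimage B continuous_intros)
      finally show ?thesis .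
    qed
    define I where "I = {V \<in> cbase. V \<noteq> {} \<and> V \<subseteq> U}"
    have cI: "countable I"
      unfolding I_def using cbase(1) by (rule countable_subset[rotated]) auto
    have "(\<forall>\<^sub>F g in generic U. (z, g) \<in> B) \<longleftrightarrow> (\<forall>V\<in>I. \<exists>g\<in>V. (z, g) \<in> B)" for z
    proof (intro iffI ballI)
      fix V assume V: "V \<in> I" and *: "\<forall>\<^sub>F g in generic U. (z, g) \<in> B"
      then have "\<forall>\<^sub>F g in generic V. (z, g) \<in> B"
        using generic_subset unfolding I_def by blast
      moreover have "open V" "V \<noteq> {}"
        using V cbase_open by (auto simp: I_def)
      ultimately obtain g where "g \<in> V" "(z, g) \<in> B"
        by (rule generic_ex)
      then show "\<exists>g\<in>V. (z, g) \<in> B" by blast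
    next
      assume *: "\<forall>V\<in>I. \<exists>g\<in>V. (z, g) \<in> B"
      have "\<forall>\<^sub>F g in generic U. g \<in> (\<lambda>g. (z, g)) -` B"
      proof (rule generic_open_dense)
        show "open ((\<lambda>g. (z, g)) -` B)"
          by (intro open_vimage B continuous_intros)
        fix V :: "'g set"
        assume V: "open V" "V \<noteq> {}" "V \<subseteq> U"
        then obtain V' where V': "V' \<in> cbase" "V' \<noteq> {}" "V' \<subseteq> V"
          using cbase_within by (metis all_not_in_conv)
        then have "V' \<in> I" using V by (auto simp: I_def)
        then show "V \<inter> (\<lambda>g. (z, g)) -` B \<noteq> {}"
          using * V' by blast
      qed (use Basic in auto)
      then show "\<forall>\<^sub>F g in generic U. (z, g) \<in> B" by simp
    qed
    then have "{z. \<forall>\<^sub>F g in generic U. (z, g) \<in> B} = UNIV \<inter> (\<Inter>V\<in>I. {z. \<exists>g\<in>V. (z, g) \<in> B})"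
      by auto
    also have "\<dots> \<in> sets borel"
    proof -
      have "- (\<Union>V\<in>I. - {z. \<exists>g\<in>V. (z, g) \<in> B}) \<in> sets borel"
        by (intro borel_comp sets.countable_UN'' cI borel_open op)
      then show ?thesis by simp
    qed
    finally show ?case .
  next
    case Empty
    have "{z::'z. \<forall>\<^sub>F g::'g in generic U. (z, g) \<in> {}} = (if \<forall>\<^sub>F g::'g in generic U. False then UNIV else {})"
      by auto
    then show ?case by simp
  next
    case (Compl B)
    have "B \<in> sets borel" using Compl(1) by (simp add: borel_def)
    from borel_generic_compl[OF this Compl(2) Compl(3)] show ?case by simp
  next
    case (Union B)
    have B: "B i \<in> sets borel" for i using Union(1) by (simp add: borel_def)
    \<comment> \<open>The category quantifier commutes with countable intersections, so the union is
      handled as the complement of an intersection of complements.\<close>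
    have "{z. \<forall>\<^sub>F g in generic V. (z, g) \<in> - (\<Union>i. B i)} \<in> sets borel" if "open V" for V
    proof -
      have "{z. \<forall>\<^sub>F g in generic V. (z, g) \<in> - (\<Union>i. B i)}
          = - (\<Union>i. - {z. \<forall>\<^sub>F g in generic V. (z, g) \<notin> B i})"
        by (auto elim: eventually_mono intro!: generic_all_countable)
      also have "\<dots> \<in> sets borel"
        by (intro borel_comp sets.countable_UN'' countableI_type borel_generic_compl B Union(2) that)
      finally show ?thesis .
    qed
    moreover have "- (\<Union>i. B i) \<in> sets borel"
      using B by auto
    ultimately have "{z. \<forall>\<^sub>F g in generic U. (z, g) \<notin> - (\<Union>i. B i)} \<in> sets borel"
      using borel_generic_compl Union(3) by blast
    then show ?case by simp
  qed
qed

section \<open>Genericity under homeomorphisms and under the action\<close>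

lemma meager_homeo:
  fixes f :: "'a :: topological_space \<Rightarrow> 'b :: topological_space"
  assumes f: "continuous_on UNIV f" and f': "continuous_on UNIV f'"
    and inv: "\<And>x. f' (f x) = x" "\<And>y. f (f' y) = y" and A: "meager A"
  shows "meager (f ` A)"
proof -
  obtain N where N: "\<And>n::nat. nowhere_dense (N n)" "A = (\<Union>n. N n)"
    using A by (auto simp: meager_def)
  have "nowhere_dense (f ` N n)" for n
  proof -
    let ?B = "interior (closure (f ` N n))"
    have "f -` ?B \<subseteq> closure (N n)"
    proof
      fix x assume "x \<in> f -` ?B"
      then have "f' (f x) \<in> f' ` closure (f ` N n)"
        using interior_subset by blast
      also have "\<dots> \<subseteq> closure (N n)"
      proof (rule image_closure_subset)
        show "continuous_on (closure (f ` N n)) f'"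
          using f' continuous_on_subset by blast
        show "f' ` f ` N n \<subseteq> closure (N n)"
          using inv(1) closure_subset by (auto simp: image_image)
      qed simp
      finally show "x \<in> closure (N n)" by (simp add: inv)
    qed
    moreover have "open (f -` ?B)"
      using f by (intro open_vimage) auto
    ultimately have "f -` ?B = {}"
      using N(1)[of n] interior_maximal unfolding nowhere_dense_def by blast
    then have "?B = {}"
      using inv(2) by (metis empty_iff equals0I vimageI)
    then show ?thesis by (simp add: nowhere_dense_def)
  qed
  moreover have "f ` A = (\<Union>n. f ` N n)"
    using N(2) by auto
  ultimately show ?thesis
    unfolding meager_def by (intro exI[of _ "\<lambda>n. f ` N n"]) auto
qed

lemma generic_translate:
  fixes h :: "'g :: {polish_space, topological_group_add}"
  shows "(\<forall>\<^sub>F g in generic ((\<lambda>g. g + h) ` U). P g) \<longleftrightarrow> (\<forall>\<^sub>F g in generic U. P (g + h))"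
proof -
  let ?A = "{g \<in> U. \<not> P (g + h)}"
  have eq: "{g \<in> (\<lambda>g. g + h) ` U. \<not> P g} = (\<lambda>g. g + h) ` ?A"
    by auto
  have c: "continuous_on UNIV (\<lambda>g. g + k)" for k :: 'g
    by (intro continuous_intros)
  have "meager ((\<lambda>g. g + h) ` ?A) \<longleftrightarrow> meager ?A"
  proof
    assume "meager ((\<lambda>g. g + h) ` ?A)"
    from meager_homeo[OF c[of "- h"] c[of h] _ _ this] show "meager ?A"
      by (simp add: image_image add.assoc)
  next
    assume "meager ?A"
    from meager_homeo[OF c[of h] c[of "- h"] _ _ this] show "meager ((\<lambda>g. g + h) ` ?A)"
      by (simp add: add.assoc)
  qed
  then show ?thesis
    by (simp only: eventually_generic eq)
qed

lemma open_translate: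
  fixes h :: "'g :: {polish_space, topological_group_add}"
  assumes "open U"
  shows "open ((\<lambda>g. g + h) ` U)"
proof -
  have "(\<lambda>g. g + h) ` U = (\<lambda>g. g + - h) -` U"
  proof
    show "(\<lambda>g. g + - h) -` U \<subseteq> (\<lambda>g. g + h) ` U"
    proof
      fix x assume "x \<in> (\<lambda>g. g + - h) -` U"
      then show "x \<in> (\<lambda>g. g + h) ` U"
        by (intro image_eqI[of _ _ "x + - h"]) (simp_all add: add.assoc)
    qed
  qed (auto simp: add.assoc)
  also have "open \<dots>"
    by (intro open_vimage assms continuous_intros)
  finally show ?thesis .
qed

context polish_G_space
begin

lemma act_minus [simp]: "act (- g) (act g x) = x" "act g (act (- g) x) = x"
  by (simp_all add: act_zero flip: act_add)

lemma continuous_act [continuous_intros]: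
  assumes "continuous_on S a" "continuous_on S b"
  shows "continuous_on S (\<lambda>z. act (a z) (b z))"
  using continuous_on_compose2[OF act_continuous continuous_on_Pair[OF assms]] by simp

text \<open>One half of the Kuratowski-Ulam theorem; it is elementary here because the translates of
  an open dense set are open and dense.\<close>

lemma generic_translates:
  assumes "comeager C"
  shows "comeager {x. \<forall>\<^sub>F g in generic UNIV. act g x \<in> C}"
proof -
  obtain N where N: "\<And>n::nat. nowhere_dense (N n)" "- C = (\<Union>n. N n)"
    using assms by (auto simp: meager_def comeager_def)
  define D where "D n = - closure (N n)" for n
  have D: "open (D n)" for n by (simp add: D_def open_Compl)
  have D_dense: "B \<inter> D n \<noteq> {}" if "open B" "B \<noteq> {}" for B n
    using N(1)[of n] that interior_maximal[of B "closure (N n)"]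
    unfolding D_def nowhere_dense_def by blast
  have DC: "(\<Inter>n. D n) \<subseteq> C"
    using N(2) closure_subset unfolding D_def by blast
  \<comment> \<open>\<open>S V n\<close> collects the points that some element of \<open>V\<close>
    moves into \<open>D n\<close>. For a point lying in all of these with \<open>V\<close> basic,
    the open set of \<open>g\<close> with \<open>act g x \<in> D n\<close> is dense.\<close>
  define S where "S V n = (\<Union>g\<in>V. act g -` D n)" for V n
  have "\<forall>\<^sub>F x in generic UNIV. x \<in> S V n" if V: "open V" "V \<noteq> {}" for V n
  proof (rule generic_open_dense)
    show "open (S V n)"
      unfolding S_def by (intro open_UN ballI open_vimage D continuous_intros)
    fix B :: "'x set"
    assume B: "open B" "B \<noteq> {}"
    obtain g where g: "g \<in> V" using V by blast
    have "open (act (- g) -` B)"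
      by (intro open_vimage B continuous_intros)
    moreover have "act (- g) -` B \<noteq> {}"
      using B(2) by (metis act_minus(1) empty_iff equals0I vimageI)
    ultimately obtain y where "act (- g) y \<in> B" "y \<in> D n"
      using D_dense by (metis Int_emptyI vimageE)
    then have "act (- g) y \<in> B \<inter> S V n"
      using g unfolding S_def by (auto intro!: bexI[of _ g])
    then show "B \<inter> S V n \<noteq> {}" by blast
  qed auto
  then have "\<forall>\<^sub>F x in generic UNIV. \<forall>V\<in>{V \<in> cbase. V \<noteq> {}}. \<forall>n. x \<in> S V n"
    using cbase(1) cbase_open
    by (intro generic_ball_countable generic_all_countable) (auto intro: countable_subset)
  then show ?thesis
    unfolding comeager_iff_generic
  proof eventually_elim
    case (elim x)
    have "\<forall>\<^sub>F g in generic UNIV. g \<in> (\<lambda>g. act g x) -` D n" for n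
    proof (rule generic_open_dense)
      show "open ((\<lambda>g. act g x) -` D n)"
        by (intro open_vimage D continuous_intros)
      fix B :: "'g set"
      assume B: "open B" "B \<noteq> {}"
      then obtain V where "V \<in> cbase" "V \<noteq> {}" "V \<subseteq> B"
        using cbase_within by (metis all_not_in_conv)
      then show "B \<inter> (\<lambda>g. act g x) -` D n \<noteq> {}"
        using elim unfolding S_def by blast
    qed auto
    then have "\<forall>\<^sub>F g in generic UNIV. \<forall>n. g \<in> (\<lambda>g. act g x) -` D n"
      by (rule generic_all_countable)
    then show ?case
      unfolding mem_Collect_eq by eventually_elim (use DC in auto)
  qed
qed

text \<open>Replacing \<open>g\<close> by \<open>g + h\<close> is a homeomorphism of the group, so
  what is generic along an orbit does not depend on the base point.\<close>

lemma generic_act_iff: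
  "(\<forall>\<^sub>F g in generic UNIV. P (act g (act h x))) \<longleftrightarrow> (\<forall>\<^sub>F g in generic UNIV. P (act g x))"
proof -
  have "range (\<lambda>g. g + h) = (UNIV :: 'g set)"
    by (rule surjI[of _ "\<lambda>g. g - h"]) simp
  then show ?thesis
    using generic_translate[where h=h and U=UNIV and P="\<lambda>g. P (act g x)"] by (simp add: act_add)
qed

lemma G_invariant_generic: "G_invariant act {x. \<forall>\<^sub>F g in generic UNIV. P (act g x)}"
  by (simp add: G_invariant_def generic_act_iff)

end

section \<open>Countable ordinals\<close>

lemma Card_order_omega1: "Card_order omega1"
  by (rule cardSuc_Card_order[OF natLeq_Card_order])

lemma Well_order_omega1: "Well_order omega1"
  using Card_order_omega1 by (rule card_order_on_well_order_on)

lemma underS_omega1_trans: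
  assumes "\<epsilon> \<in> underS omega1 \<delta>" "\<delta> \<in> underS omega1 \<gamma>"
  shows "\<epsilon> \<in> underS omega1 \<gamma>"
proof -
  have "trans omega1" "antisym omega1"
    using Well_order_omega1 by (simp_all add: order_on_defs)
  then show ?thesis
    using assms unfolding underS_def by (auto dest: transD antisymD)
qed

lemma wf_omega1: "wf (omega1 - Id)"
  using Well_order_omega1 by (simp add: well_order_on_def)

lemma omega1_induct [case_names less]:
  assumes "\<And>\<delta>. (\<And>\<epsilon>. \<epsilon> \<in> underS omega1 \<delta> \<Longrightarrow> P \<epsilon>) \<Longrightarrow> P \<delta>"
  shows "P \<delta>"
  using wf_omega1 by (induction \<delta> rule: wf_induct_rule) (auto intro: assms simp: underS_def)

lemma countable_ordLeq_natLeq: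
  includes cardinal_syntax
  shows "countable A \<longleftrightarrow> |A| \<le>o natLeq"
proof -
  have "|A| \<le>o natLeq \<longleftrightarrow> |A| \<le>o |UNIV :: nat set|"
    using ordLeq_ordIso_trans[OF _ card_of_nat] ordLeq_ordIso_trans[OF _ ordIso_symmetric[OF card_of_nat]]
    by blast
  then show ?thesis
    by (simp add: countable_def flip: card_of_ordLeq)
qed

lemma countable_underS_omega1:
  includes cardinal_syntax
  shows "countable (underS omega1 \<delta>)"
proof (cases "\<delta> \<in> Field omega1")
  case True
  then have "|underS omega1 \<delta>| <o omega1"
    by (rule card_of_underS[OF Card_order_omega1])
  then show ?thesis
    by (simp add: countable_ordLeq_natLeq cardSuc_ordLeq_ordLess[OF natLeq_Card_order card_of_Card_order])
next
  case False
  then have "underS omega1 \<delta> = {}"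
    by (auto simp: underS_def Field_def)
  then show ?thesis by simp
qed

lemma infinite_omega1: "\<not> finite (Field omega1)"
  using cardSuc_finite[OF natLeq_Card_order] by (simp add: Field_natLeq)

lemma omega1_greater:
  assumes "\<delta> \<in> Field omega1"
  obtains \<gamma> where "\<gamma> \<in> Field omega1" "\<delta> \<in> underS omega1 \<gamma>"
  using infinite_Card_order_limit[OF Card_order_omega1 infinite_omega1 assms]
  by (auto simp: underS_def)

text \<open>The basic open sets on which the terms of the sequence are meager stabilize at a countable
  stage.\<close>

lemma decreasing_borel_stabilize:
  fixes E :: "nat set \<Rightarrow> 'i :: countable \<Rightarrow> 'x :: polish_space set"
  assumes borel: "\<And>\<delta> i. E \<delta> i \<in> sets borel"
    and anti: "\<And>\<epsilon> \<delta> i. \<epsilon> \<in> underS omega1 \<delta> \<Longrightarrow> E \<delta> i \<subseteq> E \<epsilon> i"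
  obtains \<beta> where "\<beta> \<in> Field omega1"
    "\<And>\<gamma> i. \<beta> \<in> underS omega1 \<gamma> \<Longrightarrow> meager (E \<beta> i - E \<gamma> i)"
proof -
  define S where "S \<delta> = {(V, i). V \<in> cbase \<and> meager (V \<inter> E \<delta> i)}" for \<delta>
  have mono: "S \<epsilon> \<subseteq> S \<delta>" if "\<epsilon> \<in> underS omega1 \<delta>" for \<epsilon> \<delta>
  proof -
    have "V \<inter> E \<delta> i \<subseteq> V \<inter> E \<epsilon> i" for V i
      using anti[OF that] by blast
    then show ?thesis
      unfolding S_def by (auto intro: meager_subset)
  qed
  have "countable (\<Union>\<delta>\<in>Field omega1. S \<delta>)"
  proof (rule countable_subset)
    show "(\<Union>\<delta>\<in>Field omega1. S \<delta>) \<subseteq> cbase \<times> (UNIV :: 'i set)"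
      by (auto simp: S_def)
    show "countable (cbase \<times> (UNIV :: 'i set) :: ('x set \<times> 'i) set)"
      by (intro countable_SIGMA cbase countableI_type)
  qed
  moreover have "relChain omega1 S"
    unfolding relChain_def
  proof (intro allI impI)
    fix \<epsilon> \<delta> assume "(\<epsilon>, \<delta>) \<in> omega1"
    then show "S \<epsilon> \<subseteq> S \<delta>"
      using mono[of \<epsilon> \<delta>] by (cases "\<epsilon> = \<delta>") (auto simp: underS_def)
  qed
  \<comment> \<open>Regularity of the successor cardinal: a countable set exhausted by an increasing
    chain of length \<open>omega1\<close> is contained in one member of the chain.\<close>
  ultimately obtain \<beta> where \<beta>: "\<beta> \<in> Field omega1" "(\<Union>\<delta>\<in>Field omega1. S \<delta>) \<subseteq> S \<beta>"
    using cardSuc_UNION[OF natLeq_Card_order, of S "\<Union>\<delta>\<in>Field omega1. S \<delta>"]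
    by (auto simp: Field_natLeq countable_ordLeq_natLeq)
  show thesis
  proof (rule that[OF \<beta>(1)], rule ccontr)
    fix \<gamma> i assume \<gamma>: "\<beta> \<in> underS omega1 \<gamma>" and "\<not> meager (E \<beta> i - E \<gamma> i)"
    then have "\<not> (\<forall>\<^sub>F x in generic UNIV. x \<notin> E \<beta> i - E \<gamma> i)"
      by (simp add: eventually_generic set_diff_eq)
    moreover have "E \<beta> i - E \<gamma> i \<in> sets borel"
      by (intro sets.Diff borel)
    \<comment> \<open>A nonmeager difference is comeager in some basic \<open>V'\<close>, where
      \<open>E \<gamma> i\<close> is meager and \<open>E \<beta> i\<close> is not, against the
      choice of \<open>\<beta>\<close>.\<close>
    ultimately obtain V where V: "open V" "V \<noteq> {}" "\<forall>\<^sub>F x in generic V. x \<in> E \<beta> i - E \<gamma> i"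
      using borel_generic_localize[OF _ open_UNIV] by metis
    obtain V' where V': "V' \<in> cbase" "V' \<noteq> {}" "V' \<subseteq> V"
      using cbase_within[OF V(1)] V(2) by (metis all_not_in_conv)
    have ev: "\<forall>\<^sub>F x in generic V'. x \<in> E \<beta> i - E \<gamma> i"
      using generic_subset[OF V(3) V'(3)] .
    have "\<forall>\<^sub>F x in generic V'. x \<notin> E \<gamma> i"
      using ev by eventually_elim simp
    then have "(V', i) \<in> S \<gamma>"
      using V'(1) by (simp add: S_def eventually_generic Int_def)
    moreover have "\<gamma> \<in> Field omega1"
      using \<gamma> by (auto simp: underS_def Field_def)
    ultimately have "(V', i) \<in> S \<beta>"
      using \<beta>(2) by blast
    then have "\<forall>\<^sub>F x in generic V'. x \<notin> E \<beta> i"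
      by (simp add: S_def eventually_generic Int_def)
    with ev have "\<forall>\<^sub>F x in generic V'. False"
      by eventually_elim simp
    then show False
      using V' cbase_open generic_ex by blast
  qed
qed


section \<open>Back-and-forth relations\<close>

text \<open>The value \<open>T x a\<close> stands for the atomic information on the tuple \<open>a\<close> in a countable structure
  attached to \<open>x\<close>.\<close>

function bf :: "('x \<Rightarrow> nat list \<Rightarrow> 'c) \<Rightarrow> nat set \<Rightarrow> 'x \<Rightarrow> nat list \<Rightarrow> 'x \<Rightarrow> nat list \<Rightarrow> bool" where
  "bf T \<delta> x a y b \<longleftrightarrow> T x a = T y b \<and>
    (\<forall>\<epsilon>\<in>underS omega1 \<delta>. (\<forall>c. \<exists>d. bf T \<epsilon> x (a @ c) y (b @ d)) \<and>
                          (\<forall>d. \<exists>c. bf T \<epsilon> x (a @ c) y (b @ d)))"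
  by pat_completeness auto
termination
  by (relation "inv_image (omega1 - Id) (\<lambda>(T, \<delta>, x, a, y, b). \<delta>)")
     (auto simp: wf_omega1 underS_def)

declare bf.simps [simp del]

lemma bf_atomic: "bf T \<delta> x a y b \<Longrightarrow> T x a = T y b"
  by (simp add: bf.simps[of T \<delta>])

lemma bf_forth:
  assumes "bf T \<delta> x a y b" "\<epsilon> \<in> underS omega1 \<delta>"
  obtains d where "bf T \<epsilon> x (a @ c) y (b @ d)"
  using assms unfolding bf.simps[of T \<delta>] by blast

lemma bf_back:
  assumes "bf T \<delta> x a y b" "\<epsilon> \<in> underS omega1 \<delta>"
  obtains c where "bf T \<epsilon> x (a @ c) y (b @ d)"
  using assms unfolding bf.simps[of T \<delta>] by blast

lemma bfI:
  assumes "T x a = T y b"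
    "\<And>\<epsilon> c. \<epsilon> \<in> underS omega1 \<delta> \<Longrightarrow> \<exists>d. bf T \<epsilon> x (a @ c) y (b @ d)"
    "\<And>\<epsilon> d. \<epsilon> \<in> underS omega1 \<delta> \<Longrightarrow> \<exists>c. bf T \<epsilon> x (a @ c) y (b @ d)"
  shows "bf T \<delta> x a y b"
  using assms by (simp add: bf.simps[of T \<delta>])

lemma bf_mono: "bf T \<delta> x a y b \<Longrightarrow> \<epsilon> \<in> underS omega1 \<delta> \<Longrightarrow> bf T \<epsilon> x a y b"
  by (rule bfI) (meson bf_atomic bf_forth bf_back underS_omega1_trans)+

lemma bf_sym: "bf T \<delta> x a y b \<Longrightarrow> bf T \<delta> y b x a"
proof (induction \<delta> arbitrary: a b rule: omega1_induct)
  case (less \<delta>)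
  show ?case
    by (rule bfI) (metis less bf_atomic bf_forth bf_back)+
qed

lemma bf_trans: "bf T \<delta> x a y b \<Longrightarrow> bf T \<delta> y b z c \<Longrightarrow> bf T \<delta> x a z c"
proof (induction \<delta> arbitrary: a b c rule: omega1_induct)
  case (less \<delta>)
  show ?case
  proof (rule bfI)
    show "T x a = T z c"
      using less.prems bf_atomic by metis
  next
    fix \<epsilon> u assume \<epsilon>: "\<epsilon> \<in> underS omega1 \<delta>"
    obtain v where "bf T \<epsilon> x (a @ u) y (b @ v)"
      using bf_forth[OF less.prems(1) \<epsilon>] .
    moreover obtain w where "bf T \<epsilon> y (b @ v) z (c @ w)"
      using bf_forth[OF less.prems(2) \<epsilon>] .
    ultimately show "\<exists>w. bf T \<epsilon> x (a @ u) z (c @ w)"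
      using less.IH[OF \<epsilon>] by blast
  next
    fix \<epsilon> w assume \<epsilon>: "\<epsilon> \<in> underS omega1 \<delta>"
    obtain v where "bf T \<epsilon> y (b @ v) z (c @ w)"
      using bf_back[OF less.prems(2) \<epsilon>] .
    moreover obtain u where "bf T \<epsilon> x (a @ u) y (b @ v)"
      using bf_back[OF less.prems(1) \<epsilon>] .
    ultimately show "\<exists>u. bf T \<epsilon> x (a @ u) z (c @ w)"
      using less.IH[OF \<epsilon>] by blast
  qed
qed

text \<open>The bijection answers every extension: \<open>p\<close> forwards and its inverse
  backwards, at all ranks.\<close>

lemma bf_bij:
  assumes p: "bij p" and T: "\<And>a. T x a = T y (map p a)"
  shows "bf T \<delta> x a y (map p a)"
proof (induction \<delta> arbitrary: a rule: omega1_induct)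
  case (less \<delta>)
  show ?case
  proof (rule bfI)
    show "T x a = T y (map p a)" by (rule T)
  next
    fix \<epsilon> c assume "\<epsilon> \<in> underS omega1 \<delta>"
    then show "\<exists>d. bf T \<epsilon> x (a @ c) y (map p a @ d)"
      using less[of \<epsilon> "a @ c"] by auto
  next
    fix \<epsilon> d assume "\<epsilon> \<in> underS omega1 \<delta>"
    moreover have "map p (map (inv p) d) = d"
      using p by (simp add: map_idI bij_is_surj surj_f_inv_f)
    ultimately show "\<exists>c. bf T \<epsilon> x (a @ c) y (map p a @ d)"
      using less[of \<epsilon> "a @ map (inv p) d"] by (metis map_append)
  qed
qed

lemma pred_Ball_countable:
  assumes "countable I" "\<And>i. i \<in> I \<Longrightarrow> Measurable.pred M (P i)"
  shows "Measurable.pred M (\<lambda>x. \<forall>i\<in>I. P i x)"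
  using assms unfolding pred_def by (intro sets.sets_Collect_countable_All')

text \<open>By induction on the rank: each clause quantifies over countably many smaller ordinals
  and countably many tuples, and \<open>T\<close> has countably many values.\<close>

lemma borel_bf:
  fixes T :: "'x :: second_countable_topology \<Rightarrow> nat list \<Rightarrow> 'c :: countable"
  assumes T: "\<And>a t. {x. T x a = t} \<in> sets borel"
  shows "{z. bf T \<delta> (fst z) a (snd z) b} \<in> sets borel"
proof -
  have "Measurable.pred borel (\<lambda>z. bf T \<delta> (fst z) a (snd z) b)"
  proof (induction \<delta> arbitrary: a b rule: omega1_induct)
    case (less \<delta>)
    have T': "Measurable.pred borel (\<lambda>x. T x a = t)" for a t
      using T by (simp add: pred_def)
    have fst: "fst \<in> borel_measurable (borel :: ('x \<times> 'x) measure)"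
      and snd: "snd \<in> borel_measurable (borel :: ('x \<times> 'x) measure)"
      by (intro borel_measurable_continuous_onI continuous_intros)+
    have "Measurable.pred borel (\<lambda>z :: 'x \<times> 'x. \<exists>t. T (fst z) a = t \<and> T (snd z) b = t)"
      by (intro pred_intros_countable pred_intros_logic measurable_compose[OF fst T']
            measurable_compose[OF snd T'])
    moreover have "(\<lambda>z :: 'x \<times> 'x. \<exists>t. T (fst z) a = t \<and> T (snd z) b = t)
        = (\<lambda>z. T (fst z) a = T (snd z) b)"
      by auto
    ultimately have "Measurable.pred borel (\<lambda>z :: 'x \<times> 'x. T (fst z) a = T (snd z) b)"
      by simp
    moreover have "Measurable.pred borel (\<lambda>z.
      \<forall>\<epsilon>\<in>underS omega1 \<delta>. (\<forall>c. \<exists>d. bf T \<epsilon> (fst z) (a @ c) (snd z) (b @ d)) \<and>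
                          (\<forall>d. \<exists>c. bf T \<epsilon> (fst z) (a @ c) (snd z) (b @ d)))"
      by (intro pred_Ball_countable countable_underS_omega1 pred_intros_logic
            pred_intros_countable less)
    ultimately show ?case
      unfolding bf.simps[of T \<delta>] by (rule pred_intros_logic(3))
  qed
  then show ?thesis
    by (simp add: pred_def)
qed


section \<open>Atomic diagrams of countable structures\<close>

datatype atom = Eq | Rel nat | Fun nat

instance atom :: countable
  by countable_datatype

text \<open>Atoms outside the signature or of the wrong length are false, so every atom can be
  evaluated at every tuple. \<open>Fun f\<close> is the graph of the function, with the value in
  front of the arguments.\<close>

fun holds :: "signature \<Rightarrow> nat_structure \<Rightarrow> atom \<Rightarrow> nat list \<Rightarrow> bool" where
  "holds L M Eq v \<longleftrightarrow> length v = 2 \<and> v ! 0 = v ! 1"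
| "holds L M (Rel r) v \<longleftrightarrow> (r, v) \<in> rel_args L \<and> fst M (r, v)"
| "holds L M (Fun f) v \<longleftrightarrow> v \<noteq> [] \<and> (f, tl v) \<in> fun_args L \<and> snd M (f, tl v) = hd v"

text \<open>Only the first \<open>length a\<close> atomic formulas are recorded, so that there are finitely many
  diagrams of a given length. Every atomic formula is recorded eventually when \<open>a\<close> is extended.\<close>

definition diagram :: "signature \<Rightarrow> nat_structure \<Rightarrow> nat list \<Rightarrow> bool list" where
  "diagram L M a = map (\<lambda>i. case from_nat i of (\<phi>, js) \<Rightarrow>
      set js \<subseteq> {..<length a} \<and> holds L M \<phi> (map ((!) a) js)) [0..<length a]"

lemma length_diagram [simp]: "length (diagram L M a) = length a"
  by (simp add: diagram_def)

lemma Mod_iso_imp_diagram: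
  assumes "Mod_iso L M N"
  obtains p where "bij p" "\<And>a. diagram L M a = diagram L N (map p a)"
proof -
  obtain p where p: "bij p"
    and rel: "\<And>r v. (r, v) \<in> rel_args L \<Longrightarrow> fst M (r, v) \<longleftrightarrow> fst N (r, map p v)"
    and fn: "\<And>f v. (f, v) \<in> fun_args L \<Longrightarrow> p (snd M (f, v)) = snd N (f, map p v)"
    using assms unfolding Mod_iso_def by blast
  have inj: "p i = p j \<longleftrightarrow> i = j" for i j
    using p by (meson bij_is_inj inj_eq)
  have holds: "holds L M \<phi> v \<longleftrightarrow> holds L N \<phi> (map p v)" for \<phi> v
  proof (cases \<phi>)
    case Eq
    then show ?thesis by (auto simp: inj)
  next
    case (Rel r)
    have "(r, map p v) \<in> rel_args L \<longleftrightarrow> (r, v) \<in> rel_args L"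
      by (simp add: rel_args_def)
    then show ?thesis using Rel rel by auto
  next
    case (Fun f)
    have "(f, map p v) \<in> fun_args L \<longleftrightarrow> (f, v) \<in> fun_args L" for v
      by (simp add: fun_args_def)
    then show ?thesis using Fun by (cases v) (auto simp: inj simp flip: fn)
  qed
  have "map ((!) (map p a)) js = map p (map ((!) a) js)" if "set js \<subseteq> {..<length a}" for js a
    using that by auto
  then have "set js \<subseteq> {..<length a} \<and> holds L M \<phi> (map ((!) a) js) \<longleftrightarrow>
      set js \<subseteq> {..<length a} \<and> holds L N \<phi> (map ((!) (map p a)) js)" for \<phi> js a
    using holds by metis
  then have "diagram L M a = diagram L N (map p a)" for a
    by (simp add: diagram_def)
  with p show thesis by (rule that)
qed

text \<open>Alternating extensions produce two enumerations \<open>s\<close> and \<open>t\<close> of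
  the natural numbers with the same atomic facts at corresponding indices. Equality atoms make
  \<open>s i \<mapsto> t i\<close> a well defined bijection, and the other atoms make it an
  isomorphism.\<close>

lemma diagram_back_and_forth_imp_Mod_iso:
  assumes init: "P [] []"
    and diag: "\<And>a b. P a b \<Longrightarrow> diagram L M a = diagram L N b"
    and forth: "\<And>a b c. P a b \<Longrightarrow> \<exists>d. P (a @ c) (b @ d)"
    and backw: "\<And>a b d. P a b \<Longrightarrow> \<exists>c. P (a @ c) (b @ d)"
  shows "Mod_iso L M N"
proof -
  have len: "length a = length b" if "P a b" for a b
    using diag[OF that] by (metis length_diagram)
  have "\<exists>F. \<forall>n. P (fst (F n)) (snd (F n)) \<and>
      (\<exists>c d. fst (F (Suc n)) = fst (F n) @ n # c \<and> snd (F (Suc n)) = snd (F n) @ d @ [n])"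
  proof (rule dependent_nat_choice)
    show "\<exists>q. P (fst q) (snd q)"
      using init by (intro exI[of _ "([], [])"]) simp
    fix q n assume "P (fst q) (snd q)"
    then obtain d where "P (fst q @ [n]) (snd q @ d)"
      using forth by blast
    then obtain c where "P ((fst q @ [n]) @ c) ((snd q @ d) @ [n])"
      using backw by blast
    then show "\<exists>q'. P (fst q') (snd q') \<and>
      (\<exists>c d. fst q' = fst q @ n # c \<and> snd q' = snd q @ d @ [n])"
      by (intro exI[of _ "(fst q @ n # c, snd q @ d @ [n])"]) auto
  qed
  then obtain F where F: "\<And>n. P (fst (F n)) (snd (F n))"
    and step: "\<And>n. \<exists>c d. fst (F (Suc n)) = fst (F n) @ n # c \<and> snd (F (Suc n)) = snd (F n) @ d @ [n]"
    by blast
  define A where "A n = fst (F n)" for n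
  define B where "B n = snd (F n)" for n
  have lenAB: "length (B n) = length (A n)" for n
    using len[OF F[of n]] by (simp add: A_def B_def)
  have lenA: "n \<le> length (A n)" for n
  proof (induction n)
    case (Suc n)
    then show ?case using step[of n] by (auto simp: A_def)
  qed simp
  have "\<exists>c d. A m = A n @ c \<and> B m = B n @ d" if "n \<le> m" for n m
    using that
  proof (induction m rule: dec_induct)
    case (step m)
    then show ?case
      using \<open>\<And>n. \<exists>c d. fst (F (Suc n)) = _ n c \<and> _ n d\<close>[of m] by (auto simp: A_def B_def)
  qed simp
  then have pre: "A m ! i = A n ! i \<and> B m ! i = B n ! i" if "n \<le> m" "i < length (A n)" for n m i
    using that lenAB by (metis nth_append)
  \<comment> \<open>Stage \<open>Suc i\<close> has length at least \<open>Suc i\<close>, so position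
    \<open>i\<close> exists there and never changes later.\<close>
  define s where "s i = A (Suc i) ! i" for i
  define t where "t i = B (Suc i) ! i" for i
  have st: "A n ! i = s i \<and> B n ! i = t i" if "i < length (A n)" for n i
    using pre[of n "Suc i" i] pre[of "Suc i" n i] that lenA[of "Suc i"]
    unfolding s_def t_def by (metis Suc_le_lessD nle_le)
  have key: "holds L M \<phi> (map s js) \<longleftrightarrow> holds L N \<phi> (map t js)" for \<phi> js
  proof -
    \<comment> \<open>The code of the atom with its index list is its place in the diagram, so the
      stage must be longer than this code as well as beyond all the indices.\<close>
    define i where "i = to_nat (\<phi>, js)"
    obtain n where n: "i < n" "set js \<subseteq> {..<n}"
    proof -
      obtain k where "\<forall>j\<in>set js. j < k"
        using finite_nat_set_iff_bounded by blast
      then show thesis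
        by (intro that[of "Suc i + k"]) auto
    qed
    have js: "set js \<subseteq> {..<length (A n)}" "i < length (A n)"
      using n lenA[of n] by auto
    have eq: "map ((!) (A n)) js = map s js" "map ((!) (B n)) js = map t js"
      using js st by auto
    have "diagram L M (A n) ! i \<longleftrightarrow> diagram L N (B n) ! i"
      using diag[OF F[of n]] by (simp add: A_def B_def)
    then show ?thesis
      using js by (simp add: diagram_def lenAB i_def eq)
  qed
  have surj: "\<exists>i. s i = n" "\<exists>i. t i = n" for n
  proof -
    obtain c d where cd: "A (Suc n) = A n @ n # c" "B (Suc n) = B n @ d @ [n]"
      using step[of n] by (auto simp: A_def B_def)
    then have "s (length (A n)) = n"
      using st[of "length (A n)" "Suc n"] by auto
    then show "\<exists>i. s i = n" by blast
    have "B (Suc n) ! (length (B n) + length d) = n" "length (B n) + length d < length (A (Suc n))"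
      using cd(2) lenAB[of "Suc n"] by (auto simp: nth_append)
    then show "\<exists>i. t i = n"
      using st[of _ "Suc n"] by metis
  qed
  have eq: "s i = s j \<longleftrightarrow> t i = t j" for i j
    using key[of Eq "[i, j]"] by simp
  define p where "p = t \<circ> inv s"
  have ps: "p (s i) = t i" for i
    using eq[of "inv s (s i)" i] surj(1) by (simp add: p_def f_inv_into_f)
  have "inj p"
    by (rule injI) (metis surj(1) ps eq)
  moreover have "surj p"
    unfolding surj_def using surj(2) ps by metis
  ultimately have "bij p" by (simp add: bij_def)
  have holds: "holds L M \<phi> v \<longleftrightarrow> holds L N \<phi> (map p v)" for \<phi> v
  proof -
    have "\<exists>js. v = map s js"
      using surj(1) by (metis ex_map_conv)
    then obtain js where "v = map s js" ..
    then show ?thesis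
      using key[of \<phi> js] by (simp add: ps comp_def)
  qed
  show ?thesis
    unfolding Mod_iso_def
  proof (intro exI[of _ p] conjI \<open>bij p\<close> ballI; clarify)
    fix r v assume "(r, v) \<in> rel_args L"
    then show "fst M (r, v) \<longleftrightarrow> fst N (r, map p v)"
      using holds[of "Rel r" v] by (auto simp: rel_args_def)
  next
    fix f v assume "(f, v) \<in> fun_args L"
    then show "p (snd M (f, v)) = snd N (f, map p v)"
      using holds[of "Fun f" "snd M (f, v) # v"] by (auto simp: fun_args_def)
  qed
qed

section \<open>Borel measurability of diagrams\<close>

lemma sets_borel_of_topology: "sets (borel_of_topology X) = sigma_sets (topspace X) {U. openin X U}"
  and space_borel_of_topology: "space (borel_of_topology X) = topspace X"
  unfolding borel_of_topology_def
  by (auto intro!: sets_measure_of space_measure_of dest: openin_subset)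

text \<open>Each atom is either constant in the structure or read off one coordinate of the product,
  which is a continuous map to a discrete space.\<close>

lemma pred_holds: "Measurable.pred (borel_of_topology (Mod L)) (\<lambda>M. holds L M \<phi> v)"
proof -
  have open_imp: "Measurable.pred (borel_of_topology (Mod L)) Q"
    if "openin (Mod L) {M \<in> topspace (Mod L). Q M}" for Q
    using that by (auto simp: pred_def sets_borel_of_topology space_borel_of_topology)
  show ?thesis
  proof (cases \<phi>)
    case Eq
    then show ?thesis by simp
  next
    case (Rel r)
    have "Measurable.pred (borel_of_topology (Mod L)) (\<lambda>M. fst M (r, v))" if "(r, v) \<in> rel_args L"
    proof (rule open_imp)
      have "continuous_map (Mod L) (discrete_topology UNIV) (\<lambda>M. fst M (r, v))"
        unfolding Mod_def
        using continuous_map_compose[OF continuous_map_fst continuous_map_product_projection[OF that]]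
        by (simp add: comp_def)
      from openin_continuous_map_preimage[OF this, of "{True}"]
      show "openin (Mod L) {M \<in> topspace (Mod L). fst M (r, v)}" by simp
    qed
    then show ?thesis
      using Rel by (cases "(r, v) \<in> rel_args L") simp_all
  next
    case (Fun f)
    have "Measurable.pred (borel_of_topology (Mod L)) (\<lambda>M. snd M (f, w) = k)"
      if "(f, w) \<in> fun_args L" for w k
    proof (rule open_imp)
      have "continuous_map (Mod L) (discrete_topology UNIV) (\<lambda>M. snd M (f, w))"
        unfolding Mod_def
        using continuous_map_compose[OF continuous_map_snd continuous_map_product_projection[OF that]]
        by (simp add: comp_def)
      from openin_continuous_map_preimage[OF this, of "{k}"]
      show "openin (Mod L) {M \<in> topspace (Mod L). snd M (f, w) = k}" by simp
    qed
    then show ?thesis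
      using Fun by (cases "v \<noteq> [] \<and> (f, tl v) \<in> fun_args L") simp_all
  qed
qed

lemma pred_diagram: "Measurable.pred (borel_of_topology (Mod L)) (\<lambda>M. diagram L M a = t)"
proof -
  have "Measurable.pred (borel_of_topology (Mod L)) (\<lambda>M. i < length a \<longrightarrow> diagram L M a ! i = t ! i)" for i
  proof (cases "i < length a")
    case True
    obtain \<phi> js where i: "from_nat i = (\<phi> :: atom, js :: nat list)"
      by (rule prod.exhaust)
    have "Measurable.pred (borel_of_topology (Mod L))
        (\<lambda>M. (set js \<subseteq> {..<length a} \<and> holds L M \<phi> (map ((!) a) js)) = t ! i)"
      by (cases "t ! i"; cases "set js \<subseteq> {..<length a}")
         (simp_all add: pred_holds pred_intros_logic(2))
    then show ?thesis
      using True by (simp add: diagram_def i)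
  qed simp
  then have pred: "Measurable.pred (borel_of_topology (Mod L))
      (\<lambda>M. length a = length t \<and> (\<forall>i. i < length a \<longrightarrow> diagram L M a ! i = t ! i))"
    by (intro pred_intros_conj1' pred_intros_countable)
  have "(\<lambda>M. diagram L M a = t)
      = (\<lambda>M. length a = length t \<and> (\<forall>i. i < length a \<longrightarrow> diagram L M a ! i = t ! i))"
    by (rule ext, subst list_eq_iff_nth_eq, unfold length_diagram, rule refl)
  then show ?thesis
    by (rule ssubst) (rule pred)
qed

section \<open>Positions of the game\<close>

text \<open>\<open>eve_pos act \<delta> V U x y\<close> says that Eve survives from a position in which \<open>(V, \<delta>, U)\<close> is the
  last move of Odd, \<open>U\<close> is a neighbourhood of \<open>y\<close>, and the next answer of Eve moves \<open>y\<close>. The two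
  kinds of turns become the same after exchanging the roles of the two points.\<close>

definition odd_step ::
  "'g :: {topological_space, zero} set \<Rightarrow> nat set \<Rightarrow> 'g set \<Rightarrow> nat set \<Rightarrow> bool" where
  "odd_step V \<delta> V' \<delta>' \<longleftrightarrow> V' = V \<and> \<delta>' = \<delta> \<or> open V' \<and> 0 \<in> V' \<and> \<delta>' \<in> underS omega1 \<delta>"

coinductive eve_pos ::
  "('g :: {topological_space, monoid_add} \<Rightarrow> 'x :: topological_space \<Rightarrow> 'x) \<Rightarrow> nat set \<Rightarrow> 'g set \<Rightarrow>
    'x set \<Rightarrow> 'x \<Rightarrow> 'x \<Rightarrow> bool" for act where
  "(\<And>V' \<delta>' U'. odd_step V \<delta> V' \<delta>' \<Longrightarrow> open U' \<Longrightarrow> x \<in> U' \<Longrightarrow>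
      \<exists>g. local_move act V U y g \<and> act g y \<in> closure U' \<and> eve_pos act \<delta>' V' U' (act g y) x) \<Longrightarrow>
    eve_pos act \<delta> V U x y"

lemma eve_posE:
  assumes "eve_pos act \<delta> V U x y" "odd_step V \<delta> V' \<delta>'" "open U'" "x \<in> U'"
  obtains g where "local_move act V U y g" "act g y \<in> closure U'" "eve_pos act \<delta>' V' U' (act g y) x"
  using assms(1) by (cases rule: eve_pos.cases) (use assms(2-) that in blast)

text \<open>The first component is the point around which Odd plays in turn \<open>t + 1\<close>,
  the second the point that Eve then moves; exchanging them after each turn merges the two kinds of
  turns. The list \<open>[1..<t + 2]\<close> holds turns \<open>1\<close> to \<open>t + 1\<close>,
  since Eve answers after seeing Odd's move.\<close>

primrec play :: "('g \<Rightarrow> 'x \<Rightarrow> 'x) \<Rightarrow> (('g, 'x) odd_move list \<Rightarrow> 'g) \<Rightarrow> 'x \<Rightarrow> 'x \<Rightarrow>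
    (nat \<Rightarrow> ('g, 'x) odd_move) \<Rightarrow> nat \<Rightarrow> 'x \<times> 'x" where
  "play act \<sigma> x y m 0 = (x, y)"
| "play act \<sigma> x y m (Suc t) =
    (act (\<sigma> (map m [1..<t + 2])) (snd (play act \<sigma> x y m t)), fst (play act \<sigma> x y m t))"

lemma play_cong: "(\<And>j. j \<le> t \<Longrightarrow> m j = m' j) \<Longrightarrow> play act \<sigma> x y m t = play act \<sigma> x y m' t"
proof (induction t)
  case (Suc t)
  then have "map m [1..<t + 2] = map m' [1..<t + 2]"
    by auto
  moreover have "play act \<sigma> x y m t = play act \<sigma> x y m' t"
    using Suc by auto
  ultimately show ?case
    by (simp only: play.simps)
qed simp

lemma play_track:
  fixes m :: "nat \<Rightarrow> ('g, 'x) odd_move"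
  defines "gy \<equiv> \<lambda>\<sigma> n. \<sigma> (map m [1..<2*n+2])"
    and "gx \<equiv> \<lambda>\<sigma> n. \<sigma> (map m [1..<2*n+3])"
  shows "play act \<sigma> x y m (2 * n) = (track act (gx \<sigma>) x n, track act (gy \<sigma>) y n)"
    and "play act \<sigma> x y m (2 * n + 1) = (track act (gy \<sigma>) y (n + 1), track act (gx \<sigma>) x n)"
proof -
  have even: "play act \<sigma> x y m (2 * n) = (track act (gx \<sigma>) x n, track act (gy \<sigma>) y n)" for n
  proof (induction n)
    case (Suc n)
    have "2 * Suc n = Suc (Suc (2 * n))" by simp
    moreover have "Suc (2 * n) + 2 = 2 * n + 3" by simp
    ultimately show ?case
      by (simp only: play.simps Suc track.simps fst_conv snd_conv gx_def gy_def)
  qed simp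
  then show "play act \<sigma> x y m (2 * n) = (track act (gx \<sigma>) x n, track act (gy \<sigma>) y n)" .
  show "play act \<sigma> x y m (2 * n + 1) = (track act (gy \<sigma>) y (n + 1), track act (gx \<sigma>) x n)"
    using even[of n] by (simp only: play.simps track.simps fst_conv snd_conv gy_def flip: Suc_eq_plus1)
qed

lemma odd_legal_iff_play:
  "odd_legal act \<alpha> x y m (\<lambda>n. \<sigma> (map m [1..<2*n+3])) (\<lambda>n. \<sigma> (map m [1..<2*n+2])) \<longleftrightarrow>
    m 0 = Odd_Move UNIV \<alpha> UNIV \<and>
    (\<forall>t. odd_step (nbhd1 (m t)) (ordnl (m t)) (nbhd1 (m (Suc t))) (ordnl (m (Suc t)))) \<and>
    (\<forall>t. open (nbhd (m (Suc t))) \<and> fst (play act \<sigma> x y m t) \<in> nbhd (m (Suc t)))"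
proof -
  have split: "(\<forall>t. P t) \<longleftrightarrow> (\<forall>n. P (2 * n)) \<and> (\<forall>n. P (2 * n + 1))" for P :: "nat \<Rightarrow> bool"
    by (metis evenE oddE)
  show ?thesis
    unfolding odd_legal_def odd_step_def
    unfolding split[of "\<lambda>t. open (nbhd (m (Suc t))) \<and> fst (play act \<sigma> x y m t) \<in> nbhd (m (Suc t))"]
    by (simp only: play_track fst_conv Suc_eq_plus1 add.assoc one_add_one)
qed

lemma eve_wins_imp_play:
  assumes "eve_wins act x y m (\<lambda>n. \<sigma> (map m [1..<2*n+3])) (\<lambda>n. \<sigma> (map m [1..<2*n+2]))"
  shows "local_move act (nbhd1 (m t)) (nbhd (m t)) (snd (play act \<sigma> x y m t)) (\<sigma> (map m [1..<t+2]))"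
    and "fst (play act \<sigma> x y m (Suc t)) \<in> closure (nbhd (m (Suc t)))"
proof -
  consider n where "t = 2 * n" | n where "t = 2 * n + 1"
    by (metis evenE oddE)
  then have "local_move act (nbhd1 (m t)) (nbhd (m t)) (snd (play act \<sigma> x y m t)) (\<sigma> (map m [1..<t+2])) \<and>
    fst (play act \<sigma> x y m (Suc t)) \<in> closure (nbhd (m (Suc t)))"
  proof cases
    case (1 n)
    then show ?thesis
      using assms[unfolded eve_wins_def, rule_format, of n]
      by (simp only: play_track Suc_eq_plus1 fst_conv snd_conv)
  next
    case (2 n)
    have *: "Suc t = 2 * (n + 1)" "t + 2 = 2 * n + 3"
      using 2 by simp_all
    show ?thesis
      unfolding * unfolding 2
      \<comment> \<open>The local move made in turn \<open>2 * n + 2\<close> is judged by clause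
        \<open>n\<close> of the winning condition, but the closure condition on the resulting point
        by clause \<open>n + 1\<close>.\<close>
      using assms[unfolded eve_wins_def, rule_format, of n]
        assms[unfolded eve_wins_def, rule_format, of "n + 1"]
      by (simp only: play_track fst_conv snd_conv)
  qed
  then show "local_move act (nbhd1 (m t)) (nbhd (m t)) (snd (play act \<sigma> x y m t)) (\<sigma> (map m [1..<t+2]))"
    and "fst (play act \<sigma> x y m (Suc t)) \<in> closure (nbhd (m (Suc t)))"
    by blast+
qed

text \<open>A finite play is extended to an infinite one by letting Odd pass forever.\<close>

lemma appr_sim_imp_eve_pos:
  fixes act :: "'g :: {topological_space, monoid_add} \<Rightarrow> 'x :: topological_space \<Rightarrow> 'x"
  assumes "appr_sim act \<alpha> x y"
  shows "eve_pos act \<alpha> UNIV UNIV x y"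
proof -
  define legal where "legal \<sigma> m \<longleftrightarrow>
    odd_legal act \<alpha> x y m (\<lambda>n. \<sigma> (map m [1..<2*n+3])) (\<lambda>n. \<sigma> (map m [1..<2*n+2]))" for \<sigma> m
  obtain \<sigma> where \<sigma>: "\<And>m. legal \<sigma> m \<Longrightarrow>
      eve_wins act x y m (\<lambda>n. \<sigma> (map m [1..<2*n+3])) (\<lambda>n. \<sigma> (map m [1..<2*n+2]))"
    using assms unfolding appr_sim_def Let_def legal_def by blast
  let ?play = "play act \<sigma> x y"
  \<comment> \<open>The invariant for the coinduction: positions reached after finitely many turns
    of a legal play against \<open>\<sigma>\<close>.\<close>
  define R where "R \<delta> V U r s \<longleftrightarrow> (\<exists>m t. legal \<sigma> m \<and> m t = Odd_Move V \<delta> U \<and> ?play m t = (r, s))"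
    for \<delta> V U r s
  have "legal \<sigma> (\<lambda>_. Odd_Move UNIV \<alpha> UNIV)"
    unfolding legal_def odd_legal_iff_play by (simp add: odd_step_def)
  then have "R \<alpha> UNIV UNIV x y"
    unfolding R_def by (intro exI[of _ "\<lambda>_. Odd_Move UNIV \<alpha> UNIV"] exI[of _ 0]) simp
  then show ?thesis
  proof (rule eve_pos.coinduct[of R])
    fix \<delta> V U r s
    assume "R \<delta> V U r s"
    then obtain m t where m: "legal \<sigma> m" "m t = Odd_Move V \<delta> U" "?play m t = (r, s)"
      unfolding R_def by blast
    have answer: "\<exists>g. local_move act V U s g \<and> act g s \<in> closure U' \<and> R \<delta>' V' U' (act g s) r"
      if step: "odd_step V \<delta> V' \<delta>'" "open U'" "r \<in> U'" for V' \<delta>' U'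
    proof -
      define m' where "m' j = (if j \<le> t then m j else
        Odd_Move V' \<delta>' (if j = Suc t then U' else UNIV))" for j
      have play: "?play m' j = ?play m j" if "j \<le> t" for j
        using that by (intro play_cong) (simp add: m'_def)
      have m0: "m 0 = Odd_Move UNIV \<alpha> UNIV"
        and m_step: "\<And>j. odd_step (nbhd1 (m j)) (ordnl (m j)) (nbhd1 (m (Suc j))) (ordnl (m (Suc j)))"
        and m_nbhd: "\<And>j. open (nbhd (m (Suc j))) \<and> fst (?play m j) \<in> nbhd (m (Suc j))"
        using m(1) unfolding legal_def odd_legal_iff_play by blast+
      have "legal \<sigma> m'"
        unfolding legal_def odd_legal_iff_play
      proof (intro conjI allI)
        show "m' 0 = Odd_Move UNIV \<alpha> UNIV"
          using m0 by (simp add: m'_def)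
        fix j
        consider "j < t" | "j = t" | "j > t" by linarith
        then show "odd_step (nbhd1 (m' j)) (ordnl (m' j)) (nbhd1 (m' (Suc j))) (ordnl (m' (Suc j)))"
        proof cases
          case 1
          then show ?thesis using m_step[of j] by (simp add: m'_def)
        next
          case 2
          then show ?thesis using step(1) m(2) by (simp add: m'_def)
        qed (simp add: m'_def odd_step_def)
        show "open (nbhd (m' (Suc j)))"
          using step(2) m_nbhd[of j] by (auto simp: m'_def)
        consider "j < t" | "j = t" | "j > t" by linarith
        then show "fst (?play m' j) \<in> nbhd (m' (Suc j))"
        proof cases
          case 1
          then show ?thesis using m_nbhd[of j] play[of j] by (simp add: m'_def)
        next
          case 2
          then show ?thesis using step(3) m(3) play[of j] by (simp add: m'_def)
        qed (simp add: m'_def)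
      qed
      define g where "g = \<sigma> (map m' [1..<t+2])"
      have t': "m' t = Odd_Move V \<delta> U" "m' (Suc t) = Odd_Move V' \<delta>' U'" "?play m' t = (r, s)"
        using m(2,3) play[of t] by (simp_all add: m'_def)
      have play': "?play m' (Suc t) = (act g s, r)"
        by (simp only: play.simps t' fst_conv snd_conv g_def)
      have "local_move act V U s g" "act g s \<in> closure U'"
        using eve_wins_imp_play[OF \<sigma>[OF \<open>legal \<sigma> m'\<close>], of t] play'
        by (simp_all only: t' fst_conv snd_conv g_def odd_move.sel)
      moreover have "R \<delta>' V' U' (act g s) r"
        unfolding R_def using \<open>legal \<sigma> m'\<close> t'(2) play' by blast
      ultimately show ?thesis by blast
    qed
    show "\<exists>V' \<delta>' r' U' s'. \<delta> = \<delta>' \<and> V = V' \<and> U = U' \<and> r = r' \<and> s = s' \<and>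
      (\<forall>W \<epsilon> O'. odd_step V' \<delta>' W \<epsilon> \<longrightarrow> open O' \<longrightarrow> r' \<in> O' \<longrightarrow>
        (\<exists>g. local_move act V' U' s' g \<and> act g s' \<in> closure O' \<and>
          (R \<epsilon> W O' (act g s') r' \<or> eve_pos act \<epsilon> W O' (act g s') r')))"
    proof (rule exI[of _ V], rule exI[of _ \<delta>], rule exI[of _ r], rule exI[of _ U], rule exI[of _ s],
        intro conjI refl allI impI)
      fix W \<epsilon> O'
      assume "odd_step V \<delta> W \<epsilon>" "open O'" "r \<in> O'"
      from answer[OF this]
      show "\<exists>g. local_move act V U s g \<and> act g s \<in> closure O' \<and>
          (R \<epsilon> W O' (act g s) r \<or> eve_pos act \<epsilon> W O' (act g s) r)"
        by blast
    qed
  qed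
qed

section \<open>Orbits coded by back-and-forth systems\<close>

lemma (in polish_G_space) orbit_eq_act: "orbit_eq act (act g x) (act h x)"
proof -
  have "orb act (act g x) = orb act x" for g
  proof -
    have "act k x = act ((k + - g) + g) x" for k
      by (simp add: add.assoc)
    then have "\<exists>h. act k x = act (h + g) x" for k
      by blast
    then show ?thesis
      unfolding orb_def by (auto simp flip: act_add)
  qed
  then show ?thesis by (simp add: orbit_eq_def)
qed

lemma open_contains_closure:
  fixes U :: "'x :: metric_space set"
  assumes "open U" "x \<in> U"
  obtains V where "open V" "x \<in> V" "closure V \<subseteq> U"
proof -
  obtain e where "e > 0" "cball x e \<subseteq> U"
    using assms open_contains_cball by blast
  then show thesis
    using closure_minimal[OF ball_subset_cball closed_cball, of x e]
    by (intro that[of "ball x e"]) auto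
qed

lemma open_times_nbhd:
  assumes "continuous_on UNIV (\<lambda>(g, x). f g x)" "open W" "f g x \<in> W"
  obtains N U where "open N" "g \<in> N" "open U" "x \<in> U" "\<And>h y. h \<in> N \<Longrightarrow> y \<in> U \<Longrightarrow> f h y \<in> W"
proof -
  have "open ((\<lambda>(g, x). f g x) -` W)"
    using assms(1,2) by (rule open_vimage[rotated])
  then obtain N U where "open N" "open U" "(g, x) \<in> N \<times> U" "N \<times> U \<subseteq> (\<lambda>(g, x). f g x) -` W"
    using assms(3) open_prod_elim[of _ "(g, x)"] by (metis case_prod_conv vimageI)
  then show thesis
    by (intro that[of N U]) auto
qed

lemma rprod_0: "rprod h 0 = h 0"
  and rprod_Suc: "rprod h (Suc i) = h (Suc i) + rprod h i"
  by (simp_all add: rprod_def)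

text \<open>This is what the game argument keeps of a Borel reduction: \<open>T x a\<close> stands
  for the diagram of \<open>a\<close> in the structure of \<open>x\<close>, and isomorphism enters
  only through bijections and back-and-forth systems.\<close>

locale orbit_coding = polish_G_space act
  for act :: "'g :: {polish_space, topological_group_add} \<Rightarrow> 'x :: polish_space \<Rightarrow> 'x" +
  fixes X1 :: "'x set" and T :: "'x \<Rightarrow> nat list \<Rightarrow> 'c :: countable"
  assumes comeager_X1: "comeager X1"
    and T_borel: "{x. T x a = t} \<in> sets borel"
    and T_Nil: "x \<in> X1 \<Longrightarrow> y \<in> X1 \<Longrightarrow> T x [] = T y []"
    and orbit_imp_bij: "x \<in> X1 \<Longrightarrow> y \<in> X1 \<Longrightarrow> orbit_eq act x y \<Longrightarrow>
      \<exists>p. bij p \<and> (\<forall>a. T x a = T y (map p a))"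
    and back_and_forth_imp_orbit: "x \<in> X1 \<Longrightarrow> y \<in> X1 \<Longrightarrow> P [] [] \<Longrightarrow>
      (\<And>a b. P a b \<Longrightarrow> T x a = T y b) \<Longrightarrow>
      (\<And>a b c. P a b \<Longrightarrow> \<exists>d. P (a @ c) (b @ d)) \<Longrightarrow>
      (\<And>a b d. P a b \<Longrightarrow> \<exists>c. P (a @ c) (b @ d)) \<Longrightarrow> orbit_eq act x y"
begin

lemma borel_bf_comp:
  fixes f :: "'z :: topological_space \<Rightarrow> 'x"
  assumes "continuous_on UNIV f" "continuous_on UNIV f'"
  shows "{z. bf T \<delta> (f z) a (f' z) b} \<in> sets borel"
proof -
  have "(\<lambda>z. (f z, f' z)) \<in> borel_measurable borel"
    using assms by (intro borel_measurable_continuous_onI continuous_on_Pair)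
  from measurable_sets[OF this borel_bf[of T \<delta> a b]] show ?thesis
    by (simp add: vimage_def T_borel)
qed

lemma orbit_bf:
  assumes "x \<in> X1" "y \<in> X1" "orbit_eq act x y"
  obtains b where "\<And>\<delta>. bf T \<delta> x a y b"
  using orbit_imp_bij[OF assms] bf_bij by metis

text \<open>The sets of points at which two given tuples are \<delta>-equivalent in the same
  structure are Borel and decrease with \<delta>, so they stabilize modulo meager sets. The Baire
  property of the sets \<open>{x. T x a = t}\<close> makes \<open>T\<close> locally constant on
  \<open>C0\<close>.\<close>

lemma ex_stable_rank:
  obtains \<beta> \<gamma> C0 where "\<beta> \<in> underS omega1 \<gamma>" "\<gamma> \<in> Field omega1" "comeager C0" "C0 \<subseteq> X1"
    "\<And>x a b. x \<in> C0 \<Longrightarrow> bf T \<beta> x a x b \<Longrightarrow> bf T \<gamma> x a x b"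
    "\<And>x a. x \<in> C0 \<Longrightarrow> \<exists>W. open W \<and> x \<in> W \<and> (\<forall>y\<in>W \<inter> C0. T y a = T x a)"
proof -
  define E where "E \<delta> = (\<lambda>(a, b). {x. bf T \<delta> x a x b})" for \<delta>
  have "E \<delta> i \<in> sets borel" for \<delta> i
    unfolding E_def by (cases i) (simp add: borel_bf_comp continuous_on_id)
  moreover have "E \<delta> i \<subseteq> E \<epsilon> i" if "\<epsilon> \<in> underS omega1 \<delta>" for \<epsilon> \<delta> i
    unfolding E_def using bf_mono[OF _ that] by (cases i) auto
  ultimately obtain \<beta> where \<beta>: "\<beta> \<in> Field omega1"
    "\<And>\<gamma> i. \<beta> \<in> underS omega1 \<gamma> \<Longrightarrow> meager (E \<beta> i - E \<gamma> i)"
    using decreasing_borel_stabilize[of E] by blast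
  obtain \<gamma> where \<gamma>: "\<gamma> \<in> Field omega1" "\<beta> \<in> underS omega1 \<gamma>"
    using omega1_greater[OF \<beta>(1)] .
  have "\<exists>W. open W \<and> (\<forall>\<^sub>F x in generic UNIV. T x a = t \<longleftrightarrow> x \<in> W)" for a t
    using borel_imp_eventually_open[OF T_borel[of a t]] by simp
  then obtain W where W: "\<And>a t. open (W a t)"
    "\<And>a t. \<forall>\<^sub>F x in generic UNIV. T x a = t \<longleftrightarrow> x \<in> W a t"
    by metis
  define C0 where "C0 = {x \<in> X1. (\<forall>i. x \<notin> E \<beta> i - E \<gamma> i) \<and> (\<forall>a t. T x a = t \<longleftrightarrow> x \<in> W a t)}"
  have "\<forall>\<^sub>F x in generic UNIV. \<forall>i. x \<notin> E \<beta> i - E \<gamma> i"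
    using \<beta>(2)[OF \<gamma>(2)] by (intro generic_all_countable) (simp add: eventually_generic set_diff_eq)
  moreover have "\<forall>\<^sub>F x in generic UNIV. \<forall>a t. T x a = t \<longleftrightarrow> x \<in> W a t"
    by (intro generic_all_countable W)
  moreover have "\<forall>\<^sub>F x in generic UNIV. x \<in> X1"
    using comeager_X1 by (simp add: comeager_iff_generic)
  ultimately have "comeager C0"
    unfolding comeager_iff_generic by eventually_elim (simp add: C0_def)
  show thesis
  proof (rule that[OF \<gamma>(2) \<gamma>(1) \<open>comeager C0\<close>])
    show "C0 \<subseteq> X1" by (auto simp: C0_def)
    show "bf T \<gamma> x a x b" if "x \<in> C0" "bf T \<beta> x a x b" for x a b
      using that by (auto simp: C0_def E_def)
    show "\<exists>W. open W \<and> x \<in> W \<and> (\<forall>y\<in>W \<inter> C0. T y a = T x a)" if "x \<in> C0" for x a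
      using that W(1) by (intro exI[of _ "W a (T x a)"]) (auto simp: C0_def)
  qed
qed

end

section \<open>Consequences of a stable rank\<close>

locale stable_coding = orbit_coding act X1 T
  for act :: "'g :: {polish_space, topological_group_add} \<Rightarrow> 'x :: polish_space \<Rightarrow> 'x"
    and X1 and T :: "'x \<Rightarrow> nat list \<Rightarrow> 'c :: countable" +
  fixes \<beta> \<gamma> :: "nat set" and C0 :: "'x set"
  assumes \<beta>_less_\<gamma>: "\<beta> \<in> underS omega1 \<gamma>"
    and comeager_C0: "comeager C0"
    and C0_X1: "C0 \<subseteq> X1"
    and stable: "x \<in> C0 \<Longrightarrow> bf T \<beta> x a x b \<Longrightarrow> bf T \<gamma> x a x b"
    and locally_constant: "x \<in> C0 \<Longrightarrow> \<exists>W. open W \<and> x \<in> W \<and> (\<forall>y\<in>W \<inter> C0. T y a = T x a)"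
begin

text \<open>Scott's argument: lifting from \<beta> to \<gamma> and extending the tuples loses rank
  only down to \<beta> again, so \<beta>-equivalence within one structure perpetuates itself through
  all ranks.\<close>

lemma stable_all: "x \<in> C0 \<Longrightarrow> bf T \<beta> x a x b \<Longrightarrow> bf T \<delta> x a x b"
proof (induction \<delta> arbitrary: a b rule: omega1_induct)
  case (less \<delta>)
  have "bf T \<gamma> x a x b"
    using less.prems by (rule stable)
  show ?case
  proof (rule bfI)
    show "T x a = T x b"
      using less.prems(2) by (rule bf_atomic)
    show "\<exists>d. bf T \<epsilon> x (a @ c) x (b @ d)" if "\<epsilon> \<in> underS omega1 \<delta>" for \<epsilon> c
      using bf_forth[OF \<open>bf T \<gamma> x a x b\<close> \<beta>_less_\<gamma>] less that by metis
    show "\<exists>c. bf T \<epsilon> x (a @ c) x (b @ d)" if "\<epsilon> \<in> underS omega1 \<delta>" for \<epsilon> d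
      using bf_back[OF \<open>bf T \<gamma> x a x b\<close> \<beta>_less_\<gamma>] less that by metis
  qed
qed

text \<open>An isomorphism carries \<open>b\<close> to a tuple \<open>c\<close> at \<open>x\<close>
  of the same type at every rank, which reduces the claim to stability inside the structure at
  \<open>x\<close>.\<close>

lemma orbit_stable:
  assumes "x \<in> C0" "y \<in> C0" "orbit_eq act x y" "bf T \<beta> x a y b"
  shows "bf T \<delta> x a y b"
proof -
  have "orbit_eq act y x"
    using assms(3) by (simp add: orbit_eq_def)
  then obtain c where c: "\<And>\<delta>. bf T \<delta> y b x c"
    using orbit_bf[of y x b] assms(1,2) C0_X1 by blast
  have "bf T \<beta> x a x c"
    using assms(4) c by (rule bf_trans)
  then have "bf T \<delta> x a x c"
    using stable_all assms(1) by blast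
  then show ?thesis
    by (rule bf_trans[OF _ bf_sym[OF c]])
qed

text \<open>Stability lifts the given \<beta>-equivalence, one extension brings it back to \<beta>,
  and stability lifts it again.\<close>

lemma orbit_forth:
  assumes "x \<in> C0" "y \<in> C0" "orbit_eq act x y" "bf T \<beta> x a y b"
  obtains d where "\<And>\<delta>. bf T \<delta> x (a @ c) y (b @ d)"
proof -
  obtain d where "bf T \<beta> x (a @ c) y (b @ d)"
    using bf_forth[OF orbit_stable[OF assms] \<beta>_less_\<gamma>] .
  then show thesis
    using that orbit_stable[OF assms(1-3)] by blast
qed

lemma bf_imp_orbit_eq:
  assumes xy: "x \<in> C0" "y \<in> C0" and \<alpha>: "\<gamma> \<in> underS omega1 \<alpha>" and bf: "bf T \<alpha> x [] y []"
  shows "orbit_eq act x y"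
proof (rule back_and_forth_imp_orbit[where P="\<lambda>a b. bf T \<beta> x a y b"])
  \<comment> \<open>The two points are not yet known to share an orbit. Instead, rank
    \<open>\<alpha>\<close> supplies a tuple \<open>a'\<close> at \<open>x\<close> that is
    \<gamma>-equivalent to \<open>b\<close>, and stability at \<open>x\<close> compares
    \<open>a\<close> with \<open>a'\<close>.\<close>
  have up: "bf T \<gamma> x a y b" if "bf T \<beta> x a y b" for a b
  proof -
    obtain a' where a': "bf T \<gamma> x a' y b"
      using bf_back[OF bf \<alpha>, of b] by auto
    have "bf T \<beta> x a x a'"
      using that bf_sym[OF bf_mono[OF a' \<beta>_less_\<gamma>]] by (rule bf_trans)
    then have "bf T \<gamma> x a x a'"
      using stable xy(1) by blast
    then show ?thesis
      using a' by (rule bf_trans)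
  qed
  show "x \<in> X1" "y \<in> X1"
    using xy C0_X1 by auto
  show "bf T \<beta> x [] y []"
    using bf_mono[OF bf_mono[OF bf \<alpha>] \<beta>_less_\<gamma>] .
  show "T x a = T y b" if "bf T \<beta> x a y b" for a b
    using that by (rule bf_atomic)
  show "\<exists>d. bf T \<beta> x (a @ c) y (b @ d)" if "bf T \<beta> x a y b" for a b c
    using bf_forth[OF up[OF that] \<beta>_less_\<gamma>] by metis
  show "\<exists>c. bf T \<beta> x (a @ c) y (b @ d)" if "bf T \<beta> x a y b" for a b d
    using bf_back[OF up[OF that] \<beta>_less_\<gamma>] by metis
qed

section \<open>Names for tuples along an orbit\<close>

text \<open>A pair \<open>(O', a)\<close> serves as a name for a tuple that does not refer to a particular point of the
  orbit: \<open>agree O' a x y\<close> says that the name denotes at \<open>x\<close> and \<open>y\<close> tuples of the same type.\<close>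

definition agree :: "'g set \<Rightarrow> nat list \<Rightarrow> 'x \<Rightarrow> 'x \<Rightarrow> bool" where
  "agree O' a x y \<longleftrightarrow>
    (\<forall>\<^sub>F g in generic O'. \<forall>\<^sub>F g' in generic O'. bf T \<beta> (act g x) a (act g' y) a)"

lemma agree_mono: "agree O' a x y \<Longrightarrow> O'' \<subseteq> O' \<Longrightarrow> agree O'' a x y"
  unfolding agree_def by (elim generic_subset[THEN eventually_mono]) (auto intro: generic_subset)

lemma agree_trans:
  assumes xy: "agree O' a x y" and yz: "agree O' a y z" and O': "open O'" "O' \<noteq> {}"
  shows "agree O' a x z"
  unfolding agree_def
  using xy[unfolded agree_def]
proof eventually_elim
  case (elim g)
  have "\<forall>\<^sub>F p in generic O'. bf T \<beta> (act g x) a (act p y) a \<and>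
      (\<forall>\<^sub>F g' in generic O'. bf T \<beta> (act p y) a (act g' z) a)"
    using elim yz unfolding agree_def by (rule eventually_conj)
  from generic_ex[OF this O'] obtain p where "bf T \<beta> (act g x) a (act p y) a"
    "\<forall>\<^sub>F g' in generic O'. bf T \<beta> (act p y) a (act g' z) a"
    by blast
  then show ?case
    by (auto elim!: eventually_mono intro: bf_trans)
qed

text \<open>Instead of exchanging the two category quantifiers, one generic \<open>p\<close> is
  fixed; the tuples at generic translates of \<open>x\<close> and of \<open>y\<close> are all
  compared with the one at \<open>act p x\<close>.\<close>

lemma agree_sym:
  assumes xy: "agree O' a x y" and xx: "agree O' a x x" and O': "open O'" "O' \<noteq> {}"
  shows "agree O' a y x"
proof -
  have "\<forall>\<^sub>F p in generic O'. (\<forall>\<^sub>F g in generic O'. bf T \<beta> (act p x) a (act g y) a) \<and>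
      (\<forall>\<^sub>F g in generic O'. bf T \<beta> (act p x) a (act g x) a)"
    using xy xx unfolding agree_def by (rule eventually_conj)
  from generic_ex[OF this O'] obtain p where p: "\<forall>\<^sub>F g in generic O'. bf T \<beta> (act p x) a (act g y) a"
    "\<forall>\<^sub>F g in generic O'. bf T \<beta> (act p x) a (act g x) a"
    by blast
  show ?thesis
    unfolding agree_def using p(1)
  proof eventually_elim
    case (elim g)
    from p(2) show ?case
      by eventually_elim (rule bf_trans[OF bf_sym[OF elim]])
  qed
qed

lemma agree_translate: "agree O' a (act h x) (act h x) \<longleftrightarrow> agree ((\<lambda>g. g + h) ` O') a x x"
  by (simp add: agree_def generic_translate act_add)

text \<open>A small move \<open>h\<close> does not change the type named by \<open>(O', a)\<close>, since \<open>O'\<close> meets its translate.\<close>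

lemma agree_act:
  assumes x: "agree O' a x x" and hx: "agree O' a (act h x) (act h x)"
    and O': "open O'" "p \<in> O'" "p - h \<in> O'"
  shows "agree O' a x (act h x)"
  unfolding agree_def
  using x[unfolded agree_def]
proof eventually_elim
  case (elim g)
  let ?N = "O' \<inter> (\<lambda>g. g + h) ` O'"
  have "p \<in> ?N"
    using O'(2,3) by (auto intro!: image_eqI[of _ _ "p - h"])
  have N: "open ?N" "?N \<noteq> {}"
    using O'(1) open_translate \<open>p \<in> ?N\<close> by blast+
  \<comment> \<open>A \<open>q\<close> in \<open>?N\<close> has the form \<open>q' + h\<close> with
    \<open>q' \<in> O'\<close>, so \<open>act q x\<close> is also \<open>act q' (act h x)\<close>:
    one point read through the name from both sides.\<close>
  have "\<forall>\<^sub>F q in generic ((\<lambda>g. g + h) ` O').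
      \<forall>\<^sub>F g' in generic O'. bf T \<beta> (act q x) a (act g' (act h x)) a"
    using hx unfolding generic_translate agree_def act_add .
  from generic_subset[OF elim, of ?N] generic_subset[OF this, of ?N]
  have "\<forall>\<^sub>F q in generic ?N. bf T \<beta> (act g x) a (act q x) a \<and>
      (\<forall>\<^sub>F g' in generic O'. bf T \<beta> (act q x) a (act g' (act h x)) a)"
    by (intro eventually_conj) auto
  from generic_ex[OF this N] obtain q where "bf T \<beta> (act g x) a (act q x) a"
    "\<forall>\<^sub>F g' in generic O'. bf T \<beta> (act q x) a (act g' (act h x)) a"
    by blast
  then show ?case
    by (auto elim!: eventually_mono intro: bf_trans)
qed

lemma borel_agree:
  assumes "open O'"
  shows "{x. agree O' a x x} \<in> sets borel"
proof -
  have "{z. bf T \<beta> (act (snd (fst z)) (fst (fst z))) a (act (snd z) (fst (fst z))) a}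
      \<in> sets (borel :: (('x \<times> 'g) \<times> 'g) measure)"
    by (intro borel_bf_comp continuous_intros)
  from borel_generic[OF borel_generic[OF this assms, simplified], OF assms]
  show ?thesis by (simp add: agree_def)
qed

text \<open>Validity of a name throughout a region. The common value \<open>t\<close> supplies the
  atomic clause when the tuples named at two points of \<open>U\<close> are compared.\<close>

definition uniform :: "'x set \<Rightarrow> 'g set \<Rightarrow> nat list \<Rightarrow> 'x set \<Rightarrow> bool" where
  "uniform C O' a U \<longleftrightarrow>
    (\<exists>t. \<forall>z\<in>U \<inter> C. agree O' a z z \<and> (\<forall>\<^sub>F g in generic O'. T (act g z) a = t))"

text \<open>The structures at generic translates of \<open>x\<close> are isomorphic to the one at
  \<open>act g0 x\<close>, so \<open>a\<close> realizes there one of countably many types. One of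
  them occurs for nonmeagerly many \<open>g\<close> in \<open>Q\<close>, hence generically on an
  open part.\<close>

lemma ex_agree:
  assumes x: "\<forall>\<^sub>F g in generic UNIV. act g x \<in> C0" and Q: "open Q" "Q \<noteq> {}"
  obtains O' where "O' \<in> cbase" "O' \<noteq> {}" "O' \<subseteq> Q" "agree O' a x x"
proof -
  obtain g0 where g0: "act g0 x \<in> C0"
    using generic_ex[OF x open_UNIV UNIV_not_empty] by blast
  define S where "S b = {g. bf T \<beta> (act g x) a (act g0 x) b}" for b
  have S: "S b \<in> sets borel" for b
    unfolding S_def by (intro borel_bf_comp continuous_intros)
  have "\<exists>b. \<not> (\<forall>\<^sub>F g in generic Q. g \<notin> S b)"
  proof (rule ccontr)
    assume "\<not> ?thesis"
    then have "\<forall>\<^sub>F g in generic Q. \<forall>b. g \<notin> S b"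
      by (intro generic_all_countable) auto
    moreover have "\<forall>\<^sub>F g in generic Q. act g x \<in> C0"
      using generic_subset[OF x] by simp
    ultimately have "\<forall>\<^sub>F g in generic Q. (\<forall>b. g \<notin> S b) \<and> act g x \<in> C0"
      by (rule eventually_conj)
    from generic_ex[OF this Q] obtain g where g: "\<forall>b. g \<notin> S b" "act g x \<in> C0"
      by blast
    obtain b where "\<And>\<delta>. bf T \<delta> (act g x) a (act g0 x) b"
      using orbit_bf[OF _ _ orbit_eq_act] g(2) g0 C0_X1 by blast
    then show False
      using g(1) unfolding S_def by blast
  qed
  then obtain b where "\<not> (\<forall>\<^sub>F g in generic Q. g \<notin> S b)" ..
  then obtain V where V: "open V" "V \<noteq> {}" "V \<subseteq> Q" "\<forall>\<^sub>F g in generic V. g \<in> S b"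
    using borel_generic_localize[OF S Q(1)] by metis
  obtain O' where O': "O' \<in> cbase" "O' \<noteq> {}" "O' \<subseteq> V"
    using cbase_within[OF V(1)] V(2) by (metis all_not_in_conv)
  have ev: "\<forall>\<^sub>F g in generic O'. bf T \<beta> (act g x) a (act g0 x) b"
    using generic_subset[OF V(4) O'(3)] by (simp add: S_def)
  then have "agree O' a x x"
    unfolding agree_def
  proof eventually_elim
    case (elim g)
    from ev show ?case
      by eventually_elim (rule bf_trans[OF elim bf_sym])
  qed
  then show thesis
    using that O' V(3) by blast
qed

definition core :: "'x set \<Rightarrow> bool" where
  "core C \<longleftrightarrow> G_invariant act C \<and> (\<forall>x\<in>C. \<forall>\<^sub>F g in generic UNIV. act g x \<in> C0) \<and>
    (\<forall>x\<in>C. \<forall>Q a. open Q \<longrightarrow> Q \<noteq> {} \<longrightarrow>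
      (\<exists>O' U. open O' \<and> O' \<noteq> {} \<and> O' \<subseteq> Q \<and> open U \<and> x \<in> U \<and> uniform C O' a U))"

lemma core_act: "core C \<Longrightarrow> z \<in> C \<Longrightarrow> act g z \<in> C"
  by (simp add: core_def G_invariant_def)

lemma core_generic: "core C \<Longrightarrow> z \<in> C \<Longrightarrow> \<forall>\<^sub>F g in generic N. act g z \<in> C0"
  unfolding core_def by (rule generic_subset[OF _ subset_UNIV]) blast

lemma core_name:
  assumes "core C" "z \<in> C" "open Q" "Q \<noteq> {}"
  obtains O' U where "open O'" "O' \<noteq> {}" "O' \<subseteq> Q" "open U" "z \<in> U" "uniform C O' a U"
  using assms unfolding core_def by meson

text \<open>Agreement for basic open sets is Borel, hence relatively open on a comeager
  \<open>C2\<close>; \<open>C\<close> consists of the points whose translates lie generically in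
  \<open>C2\<close>. A name at a translate \<open>act g1 x\<close> is pulled back to
  \<open>x\<close> and shrunk so that it stays valid nearby.\<close>

lemma ex_core:
  obtains C where "comeager C" "core C"
proof -
  have "\<exists>W. open W \<and> (\<forall>\<^sub>F x in generic UNIV. agree O' a x x \<longleftrightarrow> x \<in> W)" if "O' \<in> cbase" for O' a
    using borel_imp_eventually_open[OF borel_agree[OF cbase_open[OF that]]] by simp
  then obtain W where W: "\<And>O' a. O' \<in> cbase \<Longrightarrow> open (W O' a)"
    "\<And>O' a. O' \<in> cbase \<Longrightarrow> \<forall>\<^sub>F x in generic UNIV. agree O' a x x \<longleftrightarrow> x \<in> W O' a"
    by metis
  define C2 where "C2 = {x \<in> C0. \<forall>O'\<in>cbase. \<forall>a. agree O' a x x \<longleftrightarrow> x \<in> W O' a}"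
  have "\<forall>\<^sub>F x in generic UNIV. \<forall>O'\<in>cbase. \<forall>a. agree O' a x x \<longleftrightarrow> x \<in> W O' a"
    by (intro generic_ball_countable cbase generic_all_countable W)
  moreover have "\<forall>\<^sub>F x in generic UNIV. x \<in> C0"
    using comeager_C0 by (simp add: comeager_iff_generic)
  ultimately have "comeager C2"
    unfolding comeager_iff_generic by eventually_elim (simp add: C2_def)
  define C where "C = {x. \<forall>\<^sub>F g in generic UNIV. act g x \<in> C2}"
  have C_C2: "\<forall>\<^sub>F g in generic N. act g x \<in> C2" if "x \<in> C" for x N
    using that generic_subset[of _ UNIV N] by (simp add: C_def)
  have C_C0: "\<forall>\<^sub>F g in generic N. act g x \<in> C0" if "x \<in> C" for x N
    using C_C2[OF that, of N] by eventually_elim (simp add: C2_def)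
  have inv: "act g x \<in> C" if "x \<in> C" for g x
    using that by (simp add: C_def generic_act_iff[of "\<lambda>z. z \<in> C2"])
  have uniform: "\<exists>O' U. open O' \<and> O' \<noteq> {} \<and> O' \<subseteq> Q \<and> open U \<and> x \<in> U \<and> uniform C O' a U"
    if x: "x \<in> C" and Q: "open Q" "Q \<noteq> {}" for x Q a
  proof -
    obtain g1 where g1: "act g1 x \<in> C2"
      using generic_ex[OF C_C2[OF x] open_UNIV UNIV_not_empty] by blast
    \<comment> \<open>Chosen so that right translation by \<open>g1\<close>, which pulls the name
      back, brings \<open>O1\<close> into \<open>Q\<close>.\<close>
    let ?Q = "(\<lambda>g. g + - g1) ` Q"
    obtain O1 where O1: "O1 \<in> cbase" "O1 \<noteq> {}" "O1 \<subseteq> ?Q" "agree O1 a (act g1 x) (act g1 x)"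
      using ex_agree[OF C_C0[OF inv[OF x]] open_translate[OF Q(1)]] Q(2) by blast
    then have g1_W: "act g1 x \<in> W O1 a"
      using g1 by (simp add: C2_def)
    obtain N U where NU: "open N" "g1 \<in> N" "open U" "x \<in> U"
      "\<And>h z. h \<in> N \<Longrightarrow> z \<in> U \<Longrightarrow> act h z \<in> W O1 a"
      by (rule open_times_nbhd[OF act_continuous W(1)[OF O1(1)] g1_W]) blast
    obtain o1 where o1: "o1 \<in> O1" using O1(2) by blast
    have cont: "continuous_on UNIV (\<lambda>(p, h). p + - h :: 'g)"
      unfolding case_prod_unfold by (intro continuous_intros)
    have mem: "(o1 + g1) + - g1 \<in> O1"
      using o1 by (simp add: add.assoc)
    \<comment> \<open>Nearby points \<open>z\<close> are moved into \<open>C2\<close> by different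
      \<open>h\<close> close to \<open>g1\<close>. \<open>O2\<close> lies in the translates of
      \<open>O1\<close> by all such \<open>h\<close>, so one name serves every
      \<open>z\<close>.\<close>
    obtain O2 N2 where O2: "open O2" "o1 + g1 \<in> O2" "open N2" "g1 \<in> N2"
      "\<And>p h. p \<in> O2 \<Longrightarrow> h \<in> N2 \<Longrightarrow> p + - h \<in> O1"
      by (rule open_times_nbhd[OF cont cbase_open[OF O1(1)] mem]) blast
    have O2_sub: "O2 \<subseteq> (\<lambda>g. g + h) ` O1" if "h \<in> N2" for h
    proof
      fix p assume "p \<in> O2"
      then have "p + - h \<in> O1" using O2(5) that by blast
      then show "p \<in> (\<lambda>g. g + h) ` O1"
        by (intro image_eqI[of _ _ "p + - h"]) (simp_all add: add.assoc)
    qed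
    have "g + g1 \<in> Q" if "g \<in> O1" for g
      using O1(3) that by auto
    then have "O2 \<subseteq> Q"
      using O2_sub[OF O2(4)] by blast
    have agree: "agree O2 a z z" if z: "z \<in> U \<inter> C" for z
    proof -
      have "\<forall>\<^sub>F h in generic (N \<inter> N2). h \<in> N \<inter> N2 \<and> act h z \<in> C2"
        using z by (intro eventually_conj generic_mem C_C2) auto
      moreover have "open (N \<inter> N2)" "N \<inter> N2 \<noteq> {}"
        using NU(1,2) O2(3,4) by blast+
      ultimately obtain h where "h \<in> N \<inter> N2 \<and> act h z \<in> C2"
        by (rule generic_ex)
      then have h: "h \<in> N" "h \<in> N2" "act h z \<in> C2"
        by blast+
      then have "agree O1 a (act h z) (act h z)"
        using NU(5) z O1(1) by (simp add: C2_def)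
      then have "agree ((\<lambda>g. g + h) ` O1) a z z"
        by (simp add: agree_translate)
      then show ?thesis
        using O2_sub[OF h(2)] by (rule agree_mono)
    qed
    \<comment> \<open>A second shrinking, around a generic \<open>g2\<close> and around
      \<open>x\<close>, makes \<open>T\<close> constant on the generic translates.\<close>
    have "\<forall>\<^sub>F g in generic O2. g \<in> O2 \<and> act g x \<in> C0"
      by (intro eventually_conj generic_mem C_C0 x)
    moreover have "O2 \<noteq> {}" using O2(2) by blast
    ultimately obtain g2 where "g2 \<in> O2 \<and> act g2 x \<in> C0"
      using O2(1) by (metis (no_types, lifting) generic_ex)
    then have g2: "g2 \<in> O2" "act g2 x \<in> C0"
      by blast+
    obtain W' where W': "open W'" "act g2 x \<in> W'" "\<And>y. y \<in> W' \<inter> C0 \<Longrightarrow> T y a = T (act g2 x) a"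
      using locally_constant[OF g2(2)] by metis
    obtain O3 U3 where O3: "open O3" "g2 \<in> O3" "open U3" "x \<in> U3"
      "\<And>h z. h \<in> O3 \<Longrightarrow> z \<in> U3 \<Longrightarrow> act h z \<in> W'"
      by (rule open_times_nbhd[OF act_continuous W'(1,2)]) blast
    have "uniform C (O2 \<inter> O3) a (U \<inter> U3)"
      unfolding uniform_def
    proof (intro exI[of _ "T (act g2 x) a"] ballI conjI)
      fix z assume z: "z \<in> U \<inter> U3 \<inter> C"
      then show "agree (O2 \<inter> O3) a z z"
        using agree agree_mono by blast
      have "\<forall>\<^sub>F g in generic (O2 \<inter> O3). g \<in> O2 \<inter> O3 \<and> act g z \<in> C0"
        using z by (intro eventually_conj generic_mem C_C0) auto
      then show "\<forall>\<^sub>F g in generic (O2 \<inter> O3). T (act g z) a = T (act g2 x) a"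
        by eventually_elim (use O3(5) W'(3) z in auto)
    qed
    then show ?thesis
      using NU O2 O3 g2(1) \<open>O2 \<subseteq> Q\<close>
      by (intro exI[of _ "O2 \<inter> O3"] exI[of _ "U \<inter> U3"]) auto
  qed
  have "comeager C"
    unfolding C_def by (rule generic_translates[OF \<open>comeager C2\<close>])
  moreover have "G_invariant act C"
    unfolding C_def by (rule G_invariant_generic)
  ultimately show thesis
    using C_C0 uniform by (intro that[of C]) (simp_all add: core_def)
qed

section \<open>The invariant of the game\<close>

text \<open>The invariant of the game: if Eve survives from a position in which both points lie in a region
  where \<open>(O', a)\<close> names a tuple and the moves from \<open>V\<close> preserve what is named, then the named
  tuples at the two points are \<open>\<delta>\<close>-equivalent. To match an extension of the tuple at \<open>x\<close>, Odd spends
  an ordinal on a neighbourhood preserving a name \<open>(O2, a @ e)\<close> of the extended tuple.\<close>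

definition position :: "'x set \<Rightarrow> nat set \<Rightarrow> 'g set \<Rightarrow> 'x set \<Rightarrow> 'x \<Rightarrow> 'x \<Rightarrow> 'g set \<Rightarrow> nat list \<Rightarrow> 'x set \<Rightarrow> bool"
  where "position C \<delta> V U x y O' a W \<longleftrightarrow> eve_pos act \<delta> V U x y \<and> x \<in> W \<inter> C \<and> y \<in> U \<inter> C \<and> U \<subseteq> W \<and>
    open W \<and> uniform C O' a W \<and> open O' \<and> O' \<noteq> {} \<and> (\<forall>h\<in>V. \<exists>p\<in>O'. p - h \<in> O')"

text \<open>The partial products of a local move keep the point in \<open>U\<close>, where the name
  is valid, so each factor preserves the named type by \<open>agree_act\<close>, and transitivity
  composes the steps.\<close>

lemma agree_local_move:
  assumes C: "G_invariant act C" and W: "uniform C O' a W" and U: "U \<subseteq> W" "y \<in> U \<inter> C"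
    and O': "open O'" "O' \<noteq> {}" and V: "\<forall>h\<in>V. \<exists>p\<in>O'. p - h \<in> O'"
    and move: "local_move act V U y g"
  shows "agree O' a y (act g y)"
proof -
  obtain k h where h: "\<forall>i\<le>k. h i \<in> V" "g = rprod h k" "\<forall>i\<le>k. act (rprod h i) y \<in> U"
    using move unfolding local_move_def by blast
  have refl: "agree O' a z z" if "z \<in> U \<inter> C" for z
    using W U(1) that unfolding uniform_def by blast
  have inC: "act g' y \<in> C" for g'
    using C U(2) unfolding G_invariant_def by blast
  have "agree O' a y (act (rprod h i) y)" if "i \<le> k" for i
    using that
  proof (induction i)
    case 0
    obtain p where "p \<in> O'" "p - h 0 \<in> O'"
      using V h(1) 0 by blast
    then show ?case
      using agree_act[OF refl[OF U(2)] refl O'(1)] h(3) 0 inC by (auto simp: rprod_0)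
  next
    case (Suc i)
    obtain p where p: "p \<in> O'" "p - h (Suc i) \<in> O'"
      using V h(1) Suc.prems by blast
    let ?z = "act (rprod h i) y"
    have eq: "act (rprod h (Suc i)) y = act (h (Suc i)) ?z"
      by (simp add: rprod_Suc act_add)
    have "agree O' a ?z (act (h (Suc i)) ?z)"
      using h(3) Suc.prems inC by (intro agree_act[OF _ _ O'(1) p] refl) (auto simp flip: eq)
    with Suc have "agree O' a y (act (h (Suc i)) ?z)"
      using agree_trans O' by (metis Suc_leD)
    then show ?case by (simp only: eq)
  qed
  then show ?thesis using h(2) by simp
qed

text \<open>The tuple \<open>c\<close> lives at one particular \<open>act g x\<close>. It is first
  traded for a named tuple at generic translates of \<open>x\<close>; Odd then plays neighbourhoods
  that protect this name, and the induction hypothesis is applied with the two points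
  exchanged.\<close>

lemma position_forth:
  assumes core: "core C" and pos: "position C \<delta> V U x y O' a W"
    and IH: "\<And>\<epsilon> V U x y O' a W. \<epsilon> \<in> underS omega1 \<delta> \<Longrightarrow> position C \<epsilon> V U x y O' a W \<Longrightarrow>
      \<forall>\<^sub>F g in generic O'. \<forall>\<^sub>F g' in generic O'. bf T \<epsilon> (act g x) a (act g' y) a"
  shows "\<forall>\<^sub>F g in generic O'. \<forall>\<^sub>F g' in generic O'.
    \<forall>\<epsilon>\<in>underS omega1 \<delta>. \<forall>c. \<exists>d. bf T \<epsilon> (act g x) (a @ c) (act g' y) (a @ d)"
proof -
  note inv = core_act[OF core] and C_C0 = core_generic[OF core]
  have eve: "eve_pos act \<delta> V U x y" and xC: "x \<in> C" and yC: "y \<in> C" and x: "x \<in> W"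
    and y: "y \<in> U \<inter> C" and UW: "U \<subseteq> W" and W: "open W" "uniform C O' a W"
    and O': "open O'" "O' \<noteq> {}" and V: "\<forall>h\<in>V. \<exists>p\<in>O'. p - h \<in> O'"
    using pos unfolding position_def by auto
  have "agree O' a x x"
    using W(2) x xC unfolding uniform_def by blast
  then have "\<forall>\<^sub>F g in generic O'. act g x \<in> C0 \<and>
      (\<forall>\<^sub>F h in generic O'. bf T \<beta> (act g x) a (act h x) a)"
    unfolding agree_def by (intro eventually_conj C_C0 xC)
  then show ?thesis
  proof eventually_elim
    case (elim g)
    show ?case
    proof (intro generic_ball_countable countable_underS_omega1 generic_all_countable)
      fix \<epsilon> c assume \<epsilon>: "\<epsilon> \<in> underS omega1 \<delta>"
      \<comment> \<open>\<open>S e\<close> holds the \<open>h\<close> for which \<open>a @ e\<close>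
        at \<open>act h x\<close> has the type of \<open>a @ c\<close> at \<open>act g x\<close>.
        Generic \<open>h\<close> admit some \<open>e\<close>, and there are countably many
        \<open>e\<close>, so some \<open>S e\<close> is nonmeager in \<open>O'\<close>.\<close>
      define S where "S e = {h. bf T \<beta> (act g x) (a @ c) (act h x) (a @ e)}" for e
      have S: "S e \<in> sets borel" for e
        unfolding S_def by (intro borel_bf_comp continuous_intros)
      have "\<exists>e. \<not> (\<forall>\<^sub>F h in generic O'. h \<notin> S e)"
      proof (rule ccontr)
        assume "\<not> ?thesis"
        then have "\<forall>\<^sub>F h in generic O'. \<forall>e. h \<notin> S e"
          by (intro generic_all_countable) auto
        from this C_C0[OF xC, of O'] elim[THEN conjunct2] have "\<forall>\<^sub>F h in generic O'. False"
        proof eventually_elim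
          case h: (elim h)
          obtain e where "\<And>\<delta>. bf T \<delta> (act g x) (a @ c) (act h x) (a @ e)"
            using orbit_forth[OF elim[THEN conjunct1] h(2) orbit_eq_act h(3)] by blast
          then show ?case
            using h(1) unfolding S_def by blast
        qed
        from generic_ex[OF this O'] show False .
      qed
      then obtain e where e: "\<not> (\<forall>\<^sub>F h in generic O'. h \<notin> S e)" ..
      obtain Q where Q: "open Q" "Q \<noteq> {}" "Q \<subseteq> O'" "\<forall>\<^sub>F h in generic Q. h \<in> S e"
        by (rule borel_generic_localize[OF S O'(1) e])
      obtain O2 W2 where O2: "open O2" "O2 \<noteq> {}" "O2 \<subseteq> Q" and W2: "open W2" "x \<in> W2"
        "uniform C O2 (a @ e) W2"
        using core_name[OF core xC Q(1,2)] .
      obtain p where p: "p \<in> O2" using O2(2) by blast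
      \<comment> \<open>The fixed \<open>p\<close> witnesses for every \<open>h\<close> in
        \<open>V2\<close> that \<open>O2\<close> meets its translate, as \<open>position\<close>
        requires.\<close>
      define V2 where "V2 = {h. p - h \<in> O2}"
      have "open V2"
      proof -
        have "open ((\<lambda>h. p - h) -` O2)"
          by (intro open_vimage O2 continuous_intros)
        then show ?thesis by (simp add: V2_def vimage_def)
      qed
      \<comment> \<open>Eve's answer is only known to land in the closure of Odd's neighbourhood, so
        this closure must lie in \<open>W2\<close>.\<close>
      obtain U2 where U2: "open U2" "x \<in> U2" "closure U2 \<subseteq> W2"
        using open_contains_closure[OF W2(1,2)] .
      have "odd_step V \<delta> V2 \<epsilon>"
        unfolding odd_step_def using \<open>open V2\<close> \<epsilon> p by (simp add: V2_def)
      then obtain k where k: "local_move act V U y k" "act k y \<in> closure U2"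
        "eve_pos act \<epsilon> V2 U2 (act k y) x"
        using eve_posE[OF eve _ U2(1,2)] by blast
      have "position C \<epsilon> V2 U2 (act k y) x O2 (a @ e) W2"
        unfolding position_def
        using k U2 W2 O2 p xC inv[OF yC] closure_subset[of U2] by (auto simp: V2_def)
      from IH[OF \<epsilon> this]
      have IH': "\<forall>\<^sub>F h in generic O2. \<forall>\<^sub>F h' in generic O2.
        bf T \<epsilon> (act h (act k y)) (a @ e) (act h' x) (a @ e)" .
      have "agree O' a y (act k y)"
        using core W(2) UW y O' V k(1) unfolding core_def by (intro agree_local_move) auto
      then have "\<forall>\<^sub>F g' in generic O'.
          \<forall>\<^sub>F h in generic O'. bf T \<beta> (act g' y) a (act h (act k y)) a"
        by (simp add: agree_def)
      with C_C0[OF yC, of O']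
      show "\<forall>\<^sub>F g' in generic O'. \<exists>d. bf T \<epsilon> (act g x) (a @ c) (act g' y) (a @ d)"
      proof eventually_elim
        case g': (elim g')
        have "\<forall>\<^sub>F h in generic O2. bf T \<beta> (act g' y) a (act h (act k y)) a \<and>
            act h (act k y) \<in> C0 \<and>
            (\<forall>\<^sub>F h' in generic O2. bf T \<epsilon> (act h (act k y)) (a @ e) (act h' x) (a @ e))"
          using O2(3) Q(3)
          by (intro eventually_conj IH' C_C0 inv yC generic_subset[OF g'(2)]) auto
        from generic_ex[OF this O2(1,2)] obtain h where
          h: "bf T \<beta> (act g' y) a (act h (act k y)) a" "act h (act k y) \<in> C0"
            "\<forall>\<^sub>F h' in generic O2. bf T \<epsilon> (act h (act k y)) (a @ e) (act h' x) (a @ e)"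
          by blast
        have "\<forall>\<^sub>F h' in generic O2. bf T \<epsilon> (act h (act k y)) (a @ e) (act h' x) (a @ e) \<and>
            h' \<in> S e \<and> act h' x \<in> C0"
          by (intro eventually_conj h(3) generic_subset[OF Q(4) O2(3)] C_C0 xC)
        from generic_ex[OF this O2(1,2)] obtain h' where
          h': "bf T \<epsilon> (act h (act k y)) (a @ e) (act h' x) (a @ e)" "h' \<in> S e" "act h' x \<in> C0"
          by blast
        have "orbit_eq act (act h (act k y)) (act g' y)"
          using orbit_eq_act by (simp flip: act_add)
        from orbit_forth[OF h(2) g'(1) this bf_sym[OF h(1)], of e] obtain d where
          d: "bf T \<epsilon> (act h (act k y)) (a @ e) (act g' y) (a @ d)"
          by blast
        \<comment> \<open>The chain runs from \<open>act g x\<close> to \<open>act h' x\<close>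
          inside the orbit of \<open>x\<close>, by the induction hypothesis to
          \<open>act h (act k y)\<close>, and inside the orbit of \<open>y\<close> to
          \<open>act g' y\<close>.\<close>
        have "bf T \<epsilon> (act g x) (a @ c) (act h' x) (a @ e)"
          using orbit_stable[OF _ h'(3) orbit_eq_act] elim h'(2) by (simp add: S_def)
        from bf_trans[OF bf_trans[OF this bf_sym[OF h'(1)]] d] show ?case
          by blast
      qed
    qed
  qed
qed

text \<open>The forth half is \<open>position_forth\<close>. For the back half Odd passes, so that
  Eve's answer leads to a position with the points exchanged and the same \<open>\<delta>\<close>;
  its forth half uses the induction hypothesis only below \<open>\<delta>\<close>.\<close>

lemma position_bf:
  assumes core: "core C"
  shows "position C \<delta> V U x y O' a W \<Longrightarrow>
    \<forall>\<^sub>F g in generic O'. \<forall>\<^sub>F g' in generic O'. bf T \<delta> (act g x) a (act g' y) a"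
proof (induction \<delta> arbitrary: V U x y O' a W rule: omega1_induct)
  case (less \<delta>)
  have forth: "\<forall>\<^sub>F g in generic O'. \<forall>\<^sub>F g' in generic O'.
      \<forall>\<epsilon>\<in>underS omega1 \<delta>. \<forall>c. \<exists>d. bf T \<epsilon> (act g x) (a @ c) (act g' y) (a @ d)"
    if "position C \<delta> V U x y O' a W" for V U x y O' a W
    using core that less.IH by (rule position_forth)
  note inv = core_act[OF core] and C_C0 = core_generic[OF core]
  have eve: "eve_pos act \<delta> V U x y" and xC: "x \<in> C" and yC: "y \<in> C" and x: "x \<in> W"
    and y: "y \<in> U \<inter> C" and UW: "U \<subseteq> W" and W: "open W" "uniform C O' a W"
    and O': "open O'" "O' \<noteq> {}" and V: "\<forall>h\<in>V. \<exists>p\<in>O'. p - h \<in> O'"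
    using less.prems unfolding position_def by auto
  obtain U2 where U2: "open U2" "x \<in> U2" "closure U2 \<subseteq> W"
    using open_contains_closure[OF W(1) x] .
  have "odd_step V \<delta> V \<delta>"
    by (simp add: odd_step_def)
  then obtain k where k: "local_move act V U y k" "act k y \<in> closure U2"
    "eve_pos act \<delta> V U2 (act k y) x"
    using eve_posE[OF eve _ U2(1,2)] by blast
  have "position C \<delta> V U2 (act k y) x O' a W"
    unfolding position_def
    using k U2 W O' V xC inv[OF yC] closure_subset[of U2] by auto
  from forth[OF this] have forth': "\<forall>\<^sub>F h in generic O'. \<forall>\<^sub>F g in generic O'.
    \<forall>\<epsilon>\<in>underS omega1 \<delta>. \<forall>c. \<exists>d. bf T \<epsilon> (act h (act k y)) (a @ c) (act g x) (a @ d)" .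
  have "agree O' a y (act k y)"
    using core W(2) UW y O' V k(1) unfolding core_def by (intro agree_local_move) auto
  moreover have "agree O' a y y"
    using W(2) UW y unfolding uniform_def by blast
  ultimately have "agree O' a (act k y) y"
    using agree_sym O' by blast
  then have "\<forall>\<^sub>F h in generic O'. act h (act k y) \<in> C0 \<and>
      (\<forall>\<^sub>F g' in generic O'. bf T \<beta> (act h (act k y)) a (act g' y) a) \<and>
      (\<forall>\<^sub>F g in generic O'. \<forall>\<epsilon>\<in>underS omega1 \<delta>. \<forall>c. \<exists>d.
        bf T \<epsilon> (act h (act k y)) (a @ c) (act g x) (a @ d))"
    unfolding agree_def by (intro eventually_conj C_C0 inv yC forth')
  from generic_ex[OF this O'] obtain h where h: "act h (act k y) \<in> C0"
    "\<forall>\<^sub>F g' in generic O'. bf T \<beta> (act h (act k y)) a (act g' y) a"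
    "\<forall>\<^sub>F g in generic O'. \<forall>\<epsilon>\<in>underS omega1 \<delta>. \<forall>c. \<exists>d.
        bf T \<epsilon> (act h (act k y)) (a @ c) (act g x) (a @ d)"
    by blast
  obtain t where t: "\<And>z. z \<in> W \<inter> C \<Longrightarrow> \<forall>\<^sub>F g in generic O'. T (act g z) a = t"
    using W(2) unfolding uniform_def by blast
  have tx: "\<forall>\<^sub>F g in generic O'. T (act g x) a = t"
    using t x xC by blast
  have ty: "\<forall>\<^sub>F g in generic O'. T (act g y) a = t"
    using t UW y by blast
  from forth[OF less.prems] h(3) tx show ?case
  proof eventually_elim
    case g: (elim g)
    from g(1) h(2) ty C_C0[OF yC, of O'] show ?case
    proof eventually_elim
      case g': (elim g')
      show ?case
      proof (rule bfI)
        show "T (act g x) a = T (act g' y) a"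
          using g(3) g'(3) by simp
        show "\<exists>d. bf T \<epsilon> (act g x) (a @ c) (act g' y) (a @ d)" if "\<epsilon> \<in> underS omega1 \<delta>" for \<epsilon> c
          using g'(1) that by blast
        show "\<exists>c. bf T \<epsilon> (act g x) (a @ c) (act g' y) (a @ d)" if \<epsilon>: "\<epsilon> \<in> underS omega1 \<delta>" for \<epsilon> d
        proof -
          \<comment> \<open>The exchanged position concerns \<open>act k y\<close>, so the extension
            \<open>d\<close> is first carried there inside the orbit of \<open>y\<close> and then
            answered at \<open>act g x\<close>.\<close>
          have "orbit_eq act (act g' y) (act h (act k y))"
            using orbit_eq_act by (simp flip: act_add)
          from orbit_forth[OF g'(4) h(1) this bf_sym[OF g'(2)], of d] obtain c where
            c: "bf T \<epsilon> (act g' y) (a @ d) (act h (act k y)) (a @ c)"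
            by blast
          obtain c' where "bf T \<epsilon> (act h (act k y)) (a @ c) (act g x) (a @ c')"
            using g(2) \<epsilon> by blast
          from bf_sym[OF bf_trans[OF c this]] show ?thesis by blast
        qed
      qed
    qed
  qed
qed

end

section \<open>From the game to equality of orbits\<close>

theorem (in orbit_coding) appr_sim_imp_orb_eq:
  obtains \<alpha> C where "\<alpha> \<in> Field omega1" "comeager C" "G_invariant act C"
    "\<And>x y. x \<in> C \<Longrightarrow> y \<in> C \<Longrightarrow> appr_sim act \<alpha> x y \<Longrightarrow> orb act x = orb act y"
proof -
  obtain \<beta> \<gamma> C0 where \<gamma>: "\<gamma> \<in> Field omega1"
    and stable: "\<beta> \<in> underS omega1 \<gamma>" "comeager C0" "C0 \<subseteq> X1"
    "\<And>x a b. x \<in> C0 \<Longrightarrow> bf T \<beta> x a x b \<Longrightarrow> bf T \<gamma> x a x b"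
    "\<And>x a. x \<in> C0 \<Longrightarrow> \<exists>W. open W \<and> x \<in> W \<and> (\<forall>y\<in>W \<inter> C0. T y a = T x a)"
    by (rule ex_stable_rank) blast
  interpret stable_coding act X1 T \<beta> \<gamma> C0
    by unfold_locales (fact stable)+
  obtain \<alpha> where \<alpha>: "\<alpha> \<in> Field omega1" "\<gamma> \<in> underS omega1 \<alpha>"
    using omega1_greater[OF \<gamma>] .
  obtain C where C: "comeager C" "core C"
    using ex_core .
  note C_C0 = core_generic[OF C(2)]
  show thesis
  proof (rule that[OF \<alpha>(1) C(1)])
    show "G_invariant act C"
      using C(2) by (simp add: core_def)
    fix x y assume xy: "x \<in> C" "y \<in> C" and "appr_sim act \<alpha> x y"
    then have eve: "eve_pos act \<alpha> UNIV UNIV x y"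
      by (intro appr_sim_imp_eve_pos)
    \<comment> \<open>The whole group names the empty tuple at every point of \<open>C\<close>,
      because isomorphisms fix it. Hence the initial position, with \<open>V\<close> and
      \<open>U\<close> everything, satisfies the invariant.\<close>
    have agree: "agree UNIV [] z z" if "z \<in> C" for z
      unfolding agree_def using C_C0[OF that]
    proof eventually_elim
      case g: (elim g)
      from C_C0[OF that] show ?case
      proof eventually_elim
        case (elim g')
        obtain p where "\<And>a. T (act g z) a = T (act g' z) (map p a)" "bij p"
          using orbit_imp_bij[OF _ _ orbit_eq_act] g elim C0_X1 by blast
        then show ?case
          using bf_bij[of p T "act g z" "act g' z" \<beta> "[]"] by simp
      qed
    qed
    obtain g0 where g0: "act g0 x \<in> C0"
      using generic_ex[OF C_C0[OF xy(1)] open_UNIV UNIV_not_empty] by blast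
    have "uniform C UNIV [] UNIV"
      unfolding uniform_def
    proof (intro exI[of _ "T (act g0 x) []"] ballI conjI)
      fix z assume z: "z \<in> UNIV \<inter> C"
      then show "agree UNIV [] z z" using agree by blast
      show "\<forall>\<^sub>F g in generic UNIV. T (act g z) [] = T (act g0 x) []"
        using C_C0[of z UNIV] z by (auto elim!: eventually_mono intro!: T_Nil C0_X1[THEN subsetD] g0)
    qed
    then have "position C \<alpha> UNIV UNIV x y UNIV [] UNIV"
      unfolding position_def using eve xy by simp
    from position_bf[OF C(2) this]
    have "\<forall>\<^sub>F g in generic UNIV. act g x \<in> C0 \<and>
        (\<forall>\<^sub>F g' in generic UNIV. bf T \<alpha> (act g x) [] (act g' y) [])"
      by (intro eventually_conj C_C0 xy)
    from generic_ex[OF this open_UNIV UNIV_not_empty] obtain g where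
      g: "act g x \<in> C0" "\<forall>\<^sub>F g' in generic UNIV. bf T \<alpha> (act g x) [] (act g' y) []"
      by blast
    have "\<forall>\<^sub>F g' in generic UNIV. act g' y \<in> C0 \<and> bf T \<alpha> (act g x) [] (act g' y) []"
      by (intro eventually_conj C_C0 xy g)
    from generic_ex[OF this open_UNIV UNIV_not_empty] obtain g' where
      g': "act g' y \<in> C0" "bf T \<alpha> (act g x) [] (act g' y) []"
      by blast
    have "orbit_eq act (act g x) (act g' y)"
      using bf_imp_orbit_eq[OF g(1) g'(1) \<alpha>(2) g'(2)] .
    moreover have "orbit_eq act x (act g x)" "orbit_eq act y (act g' y)"
      using orbit_eq_act[of 0] by (simp_all add: act_zero)
    ultimately show "orb act x = orb act y"
      by (simp add: orbit_eq_def)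
  qed
qed

section \<open>From a Borel reduction to an orbit coding\<close>

lemma comeager_contains_borel:
  assumes "comeager C"
  obtains B where "B \<subseteq> C" "comeager B" "B \<in> sets borel"
proof -
  obtain N where N: "\<And>n::nat. nowhere_dense (N n)" "- C = (\<Union>n. N n)"
    using assms by (auto simp: meager_def comeager_def)
  let ?B = "- (\<Union>n. closure (N n))"
  show thesis
  proof (rule that[of ?B])
    show "?B \<subseteq> C"
      using N(2) closure_subset by blast
    have "meager (\<Union>n. closure (N n))"
      using N(1) by (intro meager_UN_nat nowhere_dense_imp_meager) (simp add: nowhere_dense_def)
    then show "comeager ?B"
      by (simp add: comeager_def)
    show "?B \<in> sets borel"
      by (intro borel_comp sets.countable_UN'' countableI_type borel_closed closed_closure)
  qed
qed

text \<open>The empty list is the default value off \<open>X1\<close>. As \<open>X1\<close> is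
  Borel, this extends the diagram map to a Borel map on the whole space, and the conditions on
  isomorphism concern points of \<open>X1\<close> alone.\<close>

lemma (in polish_G_space) orbit_coding_reduction:
  assumes f: "f \<in> restrict_space borel X0 \<rightarrow>\<^sub>M borel_of_topology (Mod L)"
    and red: "\<And>x y. x \<in> X0 \<Longrightarrow> y \<in> X0 \<Longrightarrow> orbit_eq act x y \<longleftrightarrow> Mod_iso L (f x) (f y)"
    and X1: "X1 \<subseteq> X0" "comeager X1" "X1 \<in> sets borel"
  shows "orbit_coding act X1 (\<lambda>x a. if x \<in> X1 then diagram L (f x) a else [])"
    (is "orbit_coding act X1 ?T")
proof unfold_locales
  show "comeager X1" by (rule X1(2))
  show "{x. ?T x a = t} \<in> sets borel" for a t
  proof -
    have "{M \<in> space (borel_of_topology (Mod L)). diagram L M a = t} \<in> sets (borel_of_topology (Mod L))"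
      using pred_diagram by (simp add: pred_def)
    from measurable_sets[OF f this]
    obtain B where B: "B \<in> sets borel"
      "f -` {M \<in> space (borel_of_topology (Mod L)). diagram L M a = t} \<inter> space (restrict_space borel X0) = X0 \<inter> B"
      by (auto simp: sets_restrict_space)
    have "f x \<in> space (borel_of_topology (Mod L))" if "x \<in> X0" for x
      using measurable_space[OF f] that by (simp add: space_restrict_space)
    then have "{x \<in> X1. diagram L (f x) a = t} = X1 \<inter> B"
      using B(2) X1(1) by (auto simp: space_restrict_space)
    then have "{x. ?T x a = t} = X1 \<inter> B \<union> (if t = [] then - X1 else {})"
      by auto
    then show ?thesis
      using B(1) X1(3) by auto
  qed
  show "?T x [] = ?T y []" if "x \<in> X1" "y \<in> X1" for x y
    by (simp add: diagram_def)
  show "\<exists>p. bij p \<and> (\<forall>a. ?T x a = ?T y (map p a))"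
    if "x \<in> X1" "y \<in> X1" "orbit_eq act x y" for x y
  proof -
    have "Mod_iso L (f x) (f y)"
      using red that X1(1) by blast
    then obtain p where "bij p" "\<And>a. diagram L (f x) a = diagram L (f y) (map p a)"
      using Mod_iso_imp_diagram by blast
    then show ?thesis
      using that by auto
  qed
  show "orbit_eq act x y"
    if xy: "x \<in> X1" "y \<in> X1" and P: "P [] []" "\<And>a b. P a b \<Longrightarrow> ?T x a = ?T y b"
      "\<And>a b c. P a b \<Longrightarrow> \<exists>d. P (a @ c) (b @ d)" "\<And>a b d. P a b \<Longrightarrow> \<exists>c. P (a @ c) (b @ d)"
    for x y P
  proof -
    have "Mod_iso L (f x) (f y)"
      by (rule diagram_back_and_forth_imp_Mod_iso[of P]) (use P xy in auto)
    then show ?thesis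
      using red xy X1(1) by blast
  qed
qed

theorem theorem5p8:
  fixes act :: "'g :: {polish_space, topological_group_add} \<Rightarrow> 'x :: polish_space \<Rightarrow> 'x"
  assumes "polish_G_space act"
    and "\<And>\<alpha> C. \<alpha> \<in> Field omega1 \<Longrightarrow> comeager C \<Longrightarrow> G_invariant act C \<Longrightarrow>
           \<exists>x\<in>C. \<exists>y\<in>C. appr_sim act \<alpha> x y \<and> orb act x \<noteq> orb act y"
  shows "\<not> (\<exists>X0 :: 'x set. comeager X0 \<and>
           classifiable_by_countable_structures (restrict_space borel X0) (orbit_eq act))"
proof
  assume "\<exists>X0 :: 'x set. comeager X0 \<and>
    classifiable_by_countable_structures (restrict_space borel X0) (orbit_eq act)"
  then obtain X0 L f where X0: "comeager X0"
    and f: "f \<in> restrict_space borel X0 \<rightarrow>\<^sub>M borel_of_topology (Mod L)"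
    and red: "\<forall>x\<in>X0. \<forall>y\<in>X0. orbit_eq act x y \<longleftrightarrow> Mod_iso L (f x) (f y)"
    unfolding classifiable_by_countable_structures_def borel_reducible_def
    by (auto simp: space_restrict_space)
  \<comment> \<open>The reduction is measurable only relative to \<open>X0\<close>, which may fail
    to be Borel; a Borel comeager part allows the diagram map to be extended.\<close>
  obtain X1 where X1: "X1 \<subseteq> X0" "comeager X1" "X1 \<in> sets borel"
    using comeager_contains_borel[OF X0] .
  interpret polish_G_space act by (rule assms(1))
  interpret orbit_coding act X1 "\<lambda>x a. if x \<in> X1 then diagram L (f x) a else []"
    using f red X1 by (intro orbit_coding_reduction) auto
  obtain \<alpha> C where "\<alpha> \<in> Field omega1" "comeager C" "G_invariant act C"
    and "\<And>x y. x \<in> C \<Longrightarrow> y \<in> C \<Longrightarrow> appr_sim act \<alpha> x y \<Longrightarrow> orb act x = orb act y"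
    by (rule appr_sim_imp_orb_eq) blast
  with assms(2) show False by meson
qed

end
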